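(* For every $u,z\in W$ and any parabolic subgroup $W_J\subset W$, the coset $zW_J$ contains a unique $\preccurlyeq_u$-minimal element.
   Context: $W$ is the (finite) Weyl group of the (irreducible) root system $\Phi$ of a finite-dimensional simple Lie algebra, with Dynkin node set $I$, length $\ell$, positive roots $\Phi^+$, reflections $r_\alpha$, $\rho=\frac12\sum_{\alpha\in\Phi^+}\alpha$. A parabolic subgroup is $W_J=\langle r_i:i\in J\rangle$ for $J\subseteq I$. The quantum Bruhat graph $\mathrm{QB}(W)$ is the directed graph with vertex set $W$ and, for $w\in W$, $\alpha\in\Phi^+$, an edge $w\overset{\alpha}{\longrightarrow}wr_\alpha$ if $\ell(wr_\alpha)=\ell(w)+1$ or $\ell(wr_\alpha)=\ell(w)+1-\langle\alpha^\vee,2\rho\rangle$. Let $\ell(w_1\Rightarrow w_2)$ denote the length of a shortest directed path from $w_1$ to $w_2$ in $\mathrm{QB}(W)$ (such a path always exists). For $u\in W$, the $u$-tilted Bruhat order $\preccurlyeq_u$ is the partial order on $W$ defined by $w_1\preccurlyeq_uw_2$ if and only if $\ell(u\Rightarrow w_2)=\ell(u\Rightarrow w_1)+\ell(w_1\Rightarrow w_2)$. *)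

theory Defs
  imports "HOL-Analysis.Analysis"
begin

section \<open>Root systems and their Weyl groups\<close>

text \<open>
  The root system lives in a Euclidean space whose inner product is invariant under the Weyl
  group. The inner product identifies the space with its dual, so the coroot of \<open>\<alpha>\<close> is
  \<open>2\<alpha>/(\<alpha>,\<alpha>)\<close> and the pairing of a coroot with a weight is the inner product.
\<close>

definition coroot :: "'a::euclidean_space \<Rightarrow> 'a" where
  "coroot \<alpha> = (2 / (\<alpha> \<bullet> \<alpha>)) *\<^sub>R \<alpha>"

definition reflection :: "'a::euclidean_space \<Rightarrow> 'a \<Rightarrow> 'a" where
  "reflection \<alpha> v = v - (coroot \<alpha> \<bullet> v) *\<^sub>R \<alpha>"

text \<open>
  Reduced crystallographic root systems that span the ambient space. The root systems of the
  finite-dimensional complex simple Lie algebras are those that are moreover irreducible.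
\<close>

definition root_system :: "'a::euclidean_space set \<Rightarrow> bool" where
  "root_system \<Phi> \<longleftrightarrow>
     finite \<Phi> \<and> 0 \<notin> \<Phi> \<and> span \<Phi> = UNIV \<and>
     (\<forall>\<alpha>\<in>\<Phi>. reflection \<alpha> ` \<Phi> \<subseteq> \<Phi>) \<and>
     (\<forall>\<alpha>\<in>\<Phi>. \<forall>\<beta>\<in>\<Phi>. coroot \<alpha> \<bullet> \<beta> \<in> \<int>) \<and>
     (\<forall>\<alpha>\<in>\<Phi>. \<forall>c. c *\<^sub>R \<alpha> \<in> \<Phi> \<longrightarrow> c = 1 \<or> c = - 1)"

definition irreducible_root_system :: "'a::euclidean_space set \<Rightarrow> bool" where
  "irreducible_root_system \<Phi> \<longleftrightarrow>
     root_system \<Phi> \<and> \<Phi> \<noteq> {} \<and>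
     \<not> (\<exists>A B. A \<noteq> {} \<and> B \<noteq> {} \<and> A \<union> B = \<Phi> \<and> A \<inter> B = {} \<and> (\<forall>\<alpha>\<in>A. \<forall>\<beta>\<in>B. \<alpha> \<bullet> \<beta> = 0))"

definition nonneg_combination :: "'a::euclidean_space set \<Rightarrow> 'a \<Rightarrow> bool" where
  "nonneg_combination \<Delta> \<beta> \<longleftrightarrow> (\<exists>c :: 'a \<Rightarrow> nat. \<beta> = (\<Sum>\<delta>\<in>\<Delta>. real (c \<delta>) *\<^sub>R \<delta>))"

text \<open>
  A base \<open>\<Delta>\<close> of \<open>\<Phi>\<close> is its set of simple roots. The simple roots themselves serve as the nodes
  of the Dynkin diagram, so that subsets of \<open>\<Delta>\<close> play the role of sets of nodes.
\<close>

definition root_base :: "'a::euclidean_space set \<Rightarrow> 'a set \<Rightarrow> bool" where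
  "root_base \<Phi> \<Delta> \<longleftrightarrow>
     \<Delta> \<subseteq> \<Phi> \<and> independent \<Delta> \<and>
     (\<forall>\<beta>\<in>\<Phi>. nonneg_combination \<Delta> \<beta> \<or> nonneg_combination \<Delta> (- \<beta>))"

definition pos_roots :: "'a::euclidean_space set \<Rightarrow> 'a set \<Rightarrow> 'a set" where
  "pos_roots \<Phi> \<Delta> = {\<beta> \<in> \<Phi>. nonneg_combination \<Delta> \<beta>}"

definition weyl_vector :: "'a::euclidean_space set \<Rightarrow> 'a set \<Rightarrow> 'a" where
  "weyl_vector \<Phi> \<Delta> = (1 / 2) *\<^sub>R (\<Sum>\<alpha>\<in>pos_roots \<Phi> \<Delta>. \<alpha>)"

definition refl_prod :: "'a::euclidean_space list \<Rightarrow> 'a \<Rightarrow> 'a" where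
  "refl_prod \<alpha>s = foldr (\<lambda>\<alpha> f. reflection \<alpha> \<circ> f) \<alpha>s id"

text \<open>
  The group generated by the reflections in the elements of \<open>S\<close>; no inverses are needed, as
  reflections are involutions.
\<close>

definition refl_group :: "'a::euclidean_space set \<Rightarrow> ('a \<Rightarrow> 'a) set" where
  "refl_group S = refl_prod ` lists S"

definition weyl_group :: "'a::euclidean_space set \<Rightarrow> ('a \<Rightarrow> 'a) set" where
  "weyl_group \<Phi> = refl_group \<Phi>"

definition parabolic_subgroup :: "'a::euclidean_space set \<Rightarrow> ('a \<Rightarrow> 'a) set" where
  "parabolic_subgroup J = refl_group J"

definition left_coset :: "('a \<Rightarrow> 'a) \<Rightarrow> ('a \<Rightarrow> 'a) set \<Rightarrow> ('a \<Rightarrow> 'a) set" where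
  "left_coset z H = (\<lambda>h. z \<circ> h) ` H"

definition weyl_length :: "'a::euclidean_space set \<Rightarrow> ('a \<Rightarrow> 'a) \<Rightarrow> nat" where
  "weyl_length \<Delta> w = (LEAST n. \<exists>\<alpha>s\<in>lists \<Delta>. length \<alpha>s = n \<and> refl_prod \<alpha>s = w)"

section \<open>The quantum Bruhat graph and the tilted Bruhat order\<close>

text \<open>
  Edge labels are omitted: the label of an edge is determined by its end points and plays no role
  for the length of paths.
\<close>

definition quantum_bruhat_graph ::
    "'a::euclidean_space set \<Rightarrow> 'a set \<Rightarrow> (('a \<Rightarrow> 'a) \<times> ('a \<Rightarrow> 'a)) set" where
  "quantum_bruhat_graph \<Phi> \<Delta> =
     {(w, w \<circ> reflection \<alpha>) | w \<alpha>. w \<in> weyl_group \<Phi> \<and> \<alpha> \<in> pos_roots \<Phi> \<Delta> \<and>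
        (weyl_length \<Delta> (w \<circ> reflection \<alpha>) = weyl_length \<Delta> w + 1 \<or>
         real (weyl_length \<Delta> (w \<circ> reflection \<alpha>)) =
           real (weyl_length \<Delta> w) + 1 - coroot \<alpha> \<bullet> (2 *\<^sub>R weyl_vector \<Phi> \<Delta>))}"

text \<open>
  The length of a shortest directed path. The graph is strongly connected, so the set of lengths
  is nonempty for any two vertices.
\<close>

definition qb_dist ::
    "'a::euclidean_space set \<Rightarrow> 'a set \<Rightarrow> ('a \<Rightarrow> 'a) \<Rightarrow> ('a \<Rightarrow> 'a) \<Rightarrow> nat" where
  "qb_dist \<Phi> \<Delta> w\<^sub>1 w\<^sub>2 = (LEAST n. (w\<^sub>1, w\<^sub>2) \<in> quantum_bruhat_graph \<Phi> \<Delta> ^^ n)"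

definition tilted_le ::
    "'a::euclidean_space set \<Rightarrow> 'a set \<Rightarrow> ('a \<Rightarrow> 'a) \<Rightarrow> ('a \<Rightarrow> 'a) \<Rightarrow> ('a \<Rightarrow> 'a) \<Rightarrow> bool" where
  "tilted_le \<Phi> \<Delta> u w\<^sub>1 w\<^sub>2 \<longleftrightarrow>
     w\<^sub>1 \<in> weyl_group \<Phi> \<and> w\<^sub>2 \<in> weyl_group \<Phi> \<and>
     qb_dist \<Phi> \<Delta> u w\<^sub>2 = qb_dist \<Phi> \<Delta> u w\<^sub>1 + qb_dist \<Phi> \<Delta> w\<^sub>1 w\<^sub>2"

definition tilted_minimal ::
    "'a::euclidean_space set \<Rightarrow> 'a set \<Rightarrow> ('a \<Rightarrow> 'a) \<Rightarrow> ('a \<Rightarrow> 'a) set \<Rightarrow> ('a \<Rightarrow> 'a) \<Rightarrow> bool" where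
  "tilted_minimal \<Phi> \<Delta> u C x \<longleftrightarrow>
     x \<in> C \<and> (\<forall>y\<in>C. tilted_le \<Phi> \<Delta> u y x \<longrightarrow> y = x)"

end

theory Submission
  imports Defs
begin

text \<open>
  Call \<open>x\<close> the gate of the coset \<open>C = z W\<^sub>J\<close> as seen from \<open>u\<close> if
  \<open>\<ell>(u \<Rightarrow> y) = \<ell>(u \<Rightarrow> x) + \<ell>(x \<Rightarrow> y)\<close> for all \<open>y \<in> C\<close>. A gate is a least element
  of \<open>C\<close> for the \<open>u\<close>-tilted order, hence its only minimal element. So it suffices that every
  coset has a gate from every \<open>u\<close>, and this is proved by moving \<open>u\<close> around in \<open>W\<close> by left
  multiplications.

  The left multiplications are those with \<open>s\<^sub>a\<close>, where \<open>a\<close> is an affine simple root: a simple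
  root, or \<open>- \<theta>\<close> for the highest root \<open>\<theta>\<close>. Call \<open>a\<close> an ascent of \<open>w\<close> if \<open>w\<inverse> a\<close> is
  positive, and a descent otherwise; this is the type of \<open>w\<close> with respect to \<open>a\<close>.
  At an ascent, \<open>w \<rightarrow> s\<^sub>a w\<close> is an edge
  (lemma \<open>ascent_edge\<close>), and it is the only edge from \<open>w\<close> to an element with descent
  \<open>a\<close> (\<open>edge_ascent_descent\<close>). All edges between elements of the same type are carried to
  edges by \<open>s\<^sub>a\<close> (\<open>edge_left\<close>). These facts reduce to a count of inversions: along an edge with
  label \<open>\<gamma>\<close>, both the change of length and the quantum shift \<open>\<langle>\<gamma>\<^sup>\<vee>, 2\<rho>\<rangle>\<close> are sums over the
  positive roots that \<open>r\<^sub>\<gamma>\<close> makes negative, which leaves little room for the signs that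
  \<open>w\<close> gives to these roots (\<open>quantum_step_iff\<close>, \<open>Bruhat_step\<close>).

  Reflecting parts of paths then shows how distances behave: \<open>s\<^sub>a\<close> preserves the distance between
  elements of the same type, and for an ascent \<open>w\<close> and a descent \<open>y\<close> both
  \<open>\<ell>(s\<^sub>a w \<Rightarrow> y)\<close> and \<open>\<ell>(w \<Rightarrow> s\<^sub>a y)\<close> are \<open>\<ell>(w \<Rightarrow> y) - 1\<close>. A coset consists of ascents
  only, or of descents only, or it is stable under \<open>s\<^sub>a\<close>; in each case gates from \<open>s\<^sub>a u\<close> give
  gates from \<open>u\<close>, if \<open>a\<close> is an ascent of \<open>u\<close> (\<open>gated_pull_back\<close>). From the identity the gate
  is the shortest element of the coset (\<open>gated_id\<close>). Finally, the identity is reached from every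
  \<open>u\<close> by ascents, since a nonempty set closed under ascents is all of \<open>W\<close>
  (\<open>ascent_closed_full\<close>). This last step uses that the root system is irreducible: the highest root
  then involves all simple roots.
\<close>

section \<open>Reflections and the groups they generate\<close>

lemma linear_reflection: "linear (reflection \<alpha>)"
  unfolding reflection_def by (rule linearI) (simp_all add: algebra_simps)

lemma reflection_uminus: "reflection (- \<alpha>) = reflection \<alpha>"
  by (rule ext) (simp add: reflection_def coroot_def)

lemma coroot_inner_self: "\<alpha> \<noteq> 0 \<Longrightarrow> coroot \<alpha> \<bullet> \<alpha> = 2"
  by (simp add: coroot_def)

lemma reflection_self: "\<alpha> \<noteq> 0 \<Longrightarrow> reflection \<alpha> \<alpha> = - \<alpha>"
  by (simp add: reflection_def coroot_inner_self scaleR_2)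

lemma reflection_involutive [simp]: "reflection \<alpha> (reflection \<alpha> v) = v"
proof (cases "\<alpha> = 0")
  case False
  then show ?thesis
    using coroot_inner_self[OF False] by (simp add: reflection_def inner_diff_right algebra_simps)
qed (simp add: reflection_def coroot_def)

lemma inner_reflection: "reflection \<alpha> v \<bullet> reflection \<alpha> w = v \<bullet> w"
  by (cases "\<alpha> = 0")
    (simp_all add: reflection_def coroot_def inner_diff_left inner_diff_right inner_commute
      field_simps)

lemma coroot_reflection:
  "coroot (reflection \<beta> \<gamma>) = coroot \<gamma> - (coroot \<gamma> \<bullet> \<beta>) *\<^sub>R coroot \<beta>"
proof -
  have "coroot (reflection \<beta> \<gamma>) = (2 / (\<gamma> \<bullet> \<gamma>)) *\<^sub>R reflection \<beta> \<gamma>"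
    by (simp add: coroot_def inner_reflection)
  also have "\<dots> = coroot \<gamma> - (coroot \<gamma> \<bullet> \<beta>) *\<^sub>R coroot \<beta>"
    by (simp add: coroot_def reflection_def algebra_simps inner_commute)
  finally show ?thesis .
qed

lemma coroot_uminus: "coroot (- \<alpha>) = - coroot \<alpha>"
  by (simp add: coroot_def)

lemma refl_prod_Nil [simp]: "refl_prod [] = id"
  and refl_prod_Cons [simp]: "refl_prod (\<alpha> # \<alpha>s) = reflection \<alpha> \<circ> refl_prod \<alpha>s"
  by (simp_all add: refl_prod_def)

lemma refl_prod_append: "refl_prod (\<alpha>s @ \<beta>s) = refl_prod \<alpha>s \<circ> refl_prod \<beta>s"
  by (induction \<alpha>s) (simp_all add: comp_assoc)

lemma refl_prod_snoc: "refl_prod (\<alpha>s @ [\<alpha>]) = refl_prod \<alpha>s \<circ> reflection \<alpha>"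
  by (simp only: refl_prod_append refl_prod_Cons refl_prod_Nil comp_id)

lemma refl_prod_rev: "refl_prod (rev \<alpha>s) \<circ> refl_prod \<alpha>s = id"
proof (induction \<alpha>s)
  case (Cons \<alpha> \<alpha>s)
  have "refl_prod (rev (\<alpha> # \<alpha>s)) \<circ> refl_prod (\<alpha> # \<alpha>s)
      = refl_prod (rev \<alpha>s) \<circ> refl_prod \<alpha>s"
    by (rule ext) (simp add: refl_prod_append)
  then show ?case using Cons by metis
qed simp

lemma id_in_refl_group: "id \<in> refl_group S"
  unfolding refl_group_def by (rule image_eqI[of _ _ "[]"]) simp_all

lemma refl_group_comp: "v \<in> refl_group S \<Longrightarrow> w \<in> refl_group S \<Longrightarrow> v \<circ> w \<in> refl_group S"
  unfolding refl_group_def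
  by (elim imageE, hypsubst, subst refl_prod_append[symmetric]) (intro imageI, simp)

lemma reflection_in_refl_group: "\<alpha> \<in> S \<Longrightarrow> reflection \<alpha> \<in> refl_group S"
  unfolding refl_group_def by (rule image_eqI[of _ _ "[\<alpha>]"]) simp_all

lemma refl_group_inverse:
  assumes "w \<in> refl_group S"
  obtains w' where "w' \<in> refl_group S" "w' \<circ> w = id" "w \<circ> w' = id"
proof -
  from assms obtain \<alpha>s where \<alpha>s: "\<alpha>s \<in> lists S" "w = refl_prod \<alpha>s"
    unfolding refl_group_def by blast
  show ?thesis
  proof (rule that)
    have "rev \<alpha>s \<in> lists S" using \<alpha>s(1) by auto
    then show "refl_prod (rev \<alpha>s) \<in> refl_group S" unfolding refl_group_def by blast
    show "refl_prod (rev \<alpha>s) \<circ> w = id" using refl_prod_rev \<alpha>s by simp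
    show "w \<circ> refl_prod (rev \<alpha>s) = id" using refl_prod_rev[of "rev \<alpha>s"] \<alpha>s by simp
  qed
qed

lemma refl_group_mono: "S \<subseteq> T \<Longrightarrow> refl_group S \<subseteq> refl_group T"
  unfolding refl_group_def by (intro image_mono lists_mono)

lemma refl_group_induct [consumes 1, case_names id step]:
  assumes "w \<in> refl_group S" "P id"
    and "\<And>w \<alpha>. w \<in> refl_group S \<Longrightarrow> \<alpha> \<in> S \<Longrightarrow> P w \<Longrightarrow> P (w \<circ> reflection \<alpha>)"
  shows "P w"
proof -
  have "\<alpha>s \<in> lists S \<Longrightarrow> P (refl_prod \<alpha>s)" for \<alpha>s
  proof (induction \<alpha>s rule: rev_induct)
    case (snoc \<alpha> \<alpha>s)
    then have "refl_prod \<alpha>s \<in> refl_group S" "\<alpha> \<in> S" "P (refl_prod \<alpha>s)"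
      unfolding refl_group_def by auto
    from assms(3)[OF this] show ?case by (simp only: refl_prod_snoc)
  qed (simp add: assms(2))
  then show ?thesis using assms(1) unfolding refl_group_def by blast
qed

lemma refl_group_orthogonal:
  assumes "w \<in> refl_group S"
  shows "linear w" and "w x \<bullet> w y = x \<bullet> y"
proof -
  have "linear w \<and> (\<forall>x y. w x \<bullet> w y = x \<bullet> y)"
    using assms
  proof (induction rule: refl_group_induct)
    case (step w \<alpha>)
    then show ?case
      using linear_compose[OF linear_reflection, of w \<alpha>]
      by (simp add: inner_reflection del: o_apply) (simp add: inner_reflection)
  qed (auto simp: linear_iff)
  then show "linear w" "w x \<bullet> w y = x \<bullet> y" by auto
qed

section \<open>Positive roots and the Weyl group\<close>

locale based_root_system =
  fixes \<Phi> \<Delta> :: "'a::euclidean_space set"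
  assumes root_system: "root_system \<Phi>"
    and root_base: "root_base \<Phi> \<Delta>"
begin

abbreviation pos :: "'a set" where "pos \<equiv> pos_roots \<Phi> \<Delta>"
abbreviation W :: "('a \<Rightarrow> 'a) set" where "W \<equiv> weyl_group \<Phi>"

lemma finite_roots: "finite \<Phi>"
  and zero_not_root: "0 \<notin> \<Phi>"
  and reflection_root: "\<alpha> \<in> \<Phi> \<Longrightarrow> \<beta> \<in> \<Phi> \<Longrightarrow> reflection \<alpha> \<beta> \<in> \<Phi>"
  and pairing_integral: "\<alpha> \<in> \<Phi> \<Longrightarrow> \<beta> \<in> \<Phi> \<Longrightarrow> coroot \<alpha> \<bullet> \<beta> \<in> \<int>"
  and root_multiple: "\<alpha> \<in> \<Phi> \<Longrightarrow> c *\<^sub>R \<alpha> \<in> \<Phi> \<Longrightarrow> c = 1 \<or> c = - 1"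
  using root_system unfolding root_system_def by (simp; blast)+

lemma simple_subset: "\<Delta> \<subseteq> \<Phi>"
  and independent_simple: "independent \<Delta>"
  using root_base unfolding root_base_def by blast+

lemma finite_simple: "finite \<Delta>"
  using simple_subset finite_roots finite_subset by blast

lemma uminus_root: "\<alpha> \<in> \<Phi> \<Longrightarrow> - \<alpha> \<in> \<Phi>"
  using reflection_root[of \<alpha> \<alpha>] reflection_self[of \<alpha>] zero_not_root by metis

lemma span_simple: "span \<Delta> = UNIV"
proof -
  have comb: "nonneg_combination \<Delta> \<beta> \<Longrightarrow> \<beta> \<in> span \<Delta>" for \<beta>
    unfolding nonneg_combination_def by (auto intro: span_sum span_scale span_base)
  have "\<Phi> \<subseteq> span \<Delta>"
  proof
    fix \<beta> assume "\<beta> \<in> \<Phi>"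
    then have "nonneg_combination \<Delta> \<beta> \<or> nonneg_combination \<Delta> (- \<beta>)"
      using root_base unfolding root_base_def by blast
    then show "\<beta> \<in> span \<Delta>" using comb[of \<beta>] comb[of "- \<beta>"] span_neg[of "- \<beta>" \<Delta>] by auto
  qed
  then have "span \<Phi> \<subseteq> span \<Delta>" by (metis span_mono span_span)
  then show ?thesis using root_system unfolding root_system_def by auto
qed

definition coeff :: "'a \<Rightarrow> 'a \<Rightarrow> real" where "coeff \<delta> v = representation \<Delta> v \<delta>"

definition height :: "'a \<Rightarrow> real" where "height v = (\<Sum>\<delta>\<in>\<Delta>. coeff \<delta> v)"

lemma linear_coeff: "linear (coeff \<delta>)"
  unfolding coeff_def
  by (rule linearI)
    (use independent_simple span_simple in
      \<open>auto simp: real_vector.representation_add real_vector.representation_scale\<close>)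

lemma coeff_simple: "\<delta>' \<in> \<Delta> \<Longrightarrow> coeff \<delta> \<delta>' = (if \<delta> = \<delta>' then 1 else 0)"
  unfolding coeff_def using independent_simple by (auto simp: real_vector.representation_basis)

lemma sum_coeff: "(\<Sum>\<delta>\<in>\<Delta>. coeff \<delta> v *\<^sub>R \<delta>) = v"
  unfolding coeff_def
  using real_vector.sum_representation_eq[of \<Delta> v \<Delta>] independent_simple span_simple finite_simple
  by auto

lemma coeff_add: "coeff \<delta> (v + w) = coeff \<delta> v + coeff \<delta> w"
  and coeff_diff: "coeff \<delta> (v - w) = coeff \<delta> v - coeff \<delta> w"
  and coeff_uminus: "coeff \<delta> (- v) = - coeff \<delta> v"
  and coeff_scaleR: "coeff \<delta> (c *\<^sub>R v) = c * coeff \<delta> v"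
  and coeff_sum: "coeff \<delta> (sum f A) = (\<Sum>x\<in>A. coeff \<delta> (f x))"
  using linear_coeff[of \<delta>]
  by (simp_all add: linear_add linear_diff linear_neg linear_scale linear_sum)

lemma height_add: "height (v + w) = height v + height w"
  and height_diff: "height (v - w) = height v - height w"
  and height_uminus: "height (- v) = - height v"
  and height_scaleR: "height (c *\<^sub>R v) = c * height v"
  by (simp_all add: height_def coeff_add coeff_diff coeff_uminus coeff_scaleR sum.distrib
      sum_subtractf sum_negf sum_distrib_left)

lemma height_simple: "\<delta> \<in> \<Delta> \<Longrightarrow> height \<delta> = 1"
  by (simp add: height_def coeff_simple finite_simple)

lemma coeff_nonneg_combination:
  assumes "\<delta> \<in> \<Delta>" and "nonneg_combination \<Delta> \<beta>"
  shows "0 \<le> coeff \<delta> \<beta>"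
proof -
  from assms(2) obtain c :: "'a \<Rightarrow> nat" where c: "\<beta> = (\<Sum>\<delta>\<in>\<Delta>. real (c \<delta>) *\<^sub>R \<delta>)"
    unfolding nonneg_combination_def by blast
  have "coeff \<delta> \<beta> = (\<Sum>\<delta>'\<in>\<Delta>. real (c \<delta>') * (if \<delta> = \<delta>' then 1 else 0))"
    unfolding c coeff_sum by (intro sum.cong) (simp_all add: coeff_scaleR coeff_simple)
  also have "\<dots> = real (c \<delta>)"
    using assms(1) finite_simple by (simp add: if_distrib cong: if_cong)
  finally show ?thesis by simp
qed

lemma pos_root: "\<beta> \<in> pos \<Longrightarrow> \<beta> \<in> \<Phi>"
  by (simp add: pos_roots_def)

lemma finite_pos: "finite pos"
  using finite_roots by (simp add: pos_roots_def)

lemma pos_nonzero: "\<beta> \<in> pos \<Longrightarrow> \<beta> \<noteq> 0"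
  using pos_root zero_not_root by blast

lemma coeff_pos_nonneg: "\<delta> \<in> \<Delta> \<Longrightarrow> \<beta> \<in> pos \<Longrightarrow> 0 \<le> coeff \<delta> \<beta>"
  using coeff_nonneg_combination by (simp add: pos_roots_def)

lemma height_pos:
  assumes "\<beta> \<in> pos"
  shows "0 < height \<beta>"
proof -
  have "\<exists>\<delta>\<in>\<Delta>. coeff \<delta> \<beta> \<noteq> 0"
  proof (rule ccontr)
    assume "\<not> ?thesis"
    then have "(\<Sum>\<delta>\<in>\<Delta>. coeff \<delta> \<beta> *\<^sub>R \<delta>) = 0" by simp
    then show False using sum_coeff[of \<beta>] pos_nonzero[OF assms] by simp
  qed
  then obtain \<delta> where "\<delta> \<in> \<Delta>" "coeff \<delta> \<beta> > 0"
    using coeff_pos_nonneg[OF _ assms] by fastforce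
  then show ?thesis
    unfolding height_def using finite_simple coeff_pos_nonneg[OF _ assms] by (intro sum_pos2)
qed

lemma root_pos_or_neg: "\<beta> \<in> \<Phi> \<Longrightarrow> \<beta> \<in> pos \<or> - \<beta> \<in> pos"
  using root_base uminus_root unfolding root_base_def pos_roots_def by blast

lemma pos_iff_height: "\<beta> \<in> pos \<longleftrightarrow> \<beta> \<in> \<Phi> \<and> 0 < height \<beta>"
  using height_pos[of \<beta>] height_pos[of "- \<beta>"] root_pos_or_neg[of \<beta>] pos_root[of \<beta>]
  by (auto simp: height_uminus)

lemma uminus_pos_iff: "\<beta> \<in> \<Phi> \<Longrightarrow> - \<beta> \<in> pos \<longleftrightarrow> \<beta> \<notin> pos"
  using root_pos_or_neg[of \<beta>] height_pos[of \<beta>] height_pos[of "- \<beta>"] by (auto simp: height_uminus)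

lemma neg_height: "\<beta> \<in> \<Phi> \<Longrightarrow> \<beta> \<notin> pos \<Longrightarrow> height \<beta> < 0"
  using root_pos_or_neg[of \<beta>] height_pos[of "- \<beta>"] by (auto simp: height_uminus)

lemma simple_pos: "\<delta> \<in> \<Delta> \<Longrightarrow> \<delta> \<in> pos"
  using simple_subset by (auto simp: pos_iff_height height_simple)

lemma pos_of_coeff: "\<beta> \<in> \<Phi> \<Longrightarrow> \<delta> \<in> \<Delta> \<Longrightarrow> 0 < coeff \<delta> \<beta> \<Longrightarrow> \<beta> \<in> pos"
  using coeff_pos_nonneg[of \<delta> "- \<beta>"] root_pos_or_neg[of \<beta>] by (auto simp: coeff_uminus)

lemma pos_multiple: "\<beta> \<in> pos \<Longrightarrow> c *\<^sub>R \<beta> \<in> \<Phi> \<Longrightarrow> 0 < c \<Longrightarrow> c = 1"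
  using root_multiple[of \<beta> c] pos_root by force

text \<open>
  The root system is reduced, so a positive root other than \<open>\<alpha>\<close> is not a multiple of \<open>\<alpha>\<close>.
  The reflection in \<open>\<alpha>\<close> does not change the coefficient of a second simple root, and a single
  positive coefficient makes a root positive.
\<close>

lemma other_simple_coeff:
  assumes "\<beta> \<in> pos" "\<alpha> \<in> \<Delta>" "\<beta> \<noteq> \<alpha>"
  obtains \<delta> where "\<delta> \<in> \<Delta>" "\<delta> \<noteq> \<alpha>" "0 < coeff \<delta> \<beta>"
proof -
  have "\<exists>\<delta>\<in>\<Delta> - {\<alpha>}. coeff \<delta> \<beta> \<noteq> 0"
  proof (rule ccontr)
    assume "\<not> ?thesis"
    then have "(\<Sum>\<delta>\<in>\<Delta>. coeff \<delta> \<beta> *\<^sub>R \<delta>) = (\<Sum>\<delta>\<in>{\<alpha>}. coeff \<delta> \<beta> *\<^sub>R \<delta>)"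
      using assms(2) finite_simple by (intro sum.mono_neutral_right) auto
    then have eq: "\<beta> = coeff \<alpha> \<beta> *\<^sub>R \<alpha>" using sum_coeff[of \<beta>] by simp
    moreover have "coeff \<alpha> \<beta> > 0"
      using eq pos_nonzero[OF assms(1)] coeff_pos_nonneg[OF assms(2,1)]
      by (metis less_eq_real_def scaleR_zero_left)
    ultimately have "coeff \<alpha> \<beta> = 1"
      using pos_multiple[of \<alpha> "coeff \<alpha> \<beta>"] simple_pos[OF assms(2)] pos_root[OF assms(1)] by metis
    then show False using eq assms(3) by simp
  qed
  then show ?thesis using coeff_pos_nonneg[OF _ assms(1)] that by (metis DiffE insertI1 less_eq_real_def)
qed

lemma simple_reflection_pos:
  assumes "\<alpha> \<in> \<Delta>" "\<beta> \<in> pos" "\<beta> \<noteq> \<alpha>"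
  shows "reflection \<alpha> \<beta> \<in> pos"
proof -
  obtain \<delta> where \<delta>: "\<delta> \<in> \<Delta>" "\<delta> \<noteq> \<alpha>" "0 < coeff \<delta> \<beta>" using other_simple_coeff assms by blast
  have "coeff \<delta> (reflection \<alpha> \<beta>) = coeff \<delta> \<beta>"
    using \<delta>(2) assms(1) by (simp add: reflection_def coeff_diff coeff_scaleR coeff_simple)
  then show ?thesis
    using pos_of_coeff[of "reflection \<alpha> \<beta>" \<delta>] \<delta> reflection_root[of \<alpha> \<beta>] simple_subset assms
      pos_root by auto
qed

lemma Weyl_linear: "w \<in> W \<Longrightarrow> linear w"
  and Weyl_inner: "w \<in> W \<Longrightarrow> w x \<bullet> w y = x \<bullet> y"
  using refl_group_orthogonal unfolding weyl_group_def by blast+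

lemma Weyl_id: "id \<in> W"
  and Weyl_comp: "v \<in> W \<Longrightarrow> w \<in> W \<Longrightarrow> v \<circ> w \<in> W"
  and Weyl_reflection: "\<alpha> \<in> \<Phi> \<Longrightarrow> reflection \<alpha> \<in> W"
  unfolding weyl_group_def
  by (auto intro: id_in_refl_group refl_group_comp reflection_in_refl_group)

lemma Weyl_inverse:
  assumes "w \<in> W"
  obtains w' where "w' \<in> W" "\<And>x. w' (w x) = x" "\<And>x. w (w' x) = x"
proof -
  obtain w' where "w' \<in> W" "w' \<circ> w = id" "w \<circ> w' = id"
    using refl_group_inverse assms unfolding weyl_group_def by blast
  then show ?thesis using that by (metis comp_apply id_apply)
qed

lemma Weyl_uminus: "w \<in> W \<Longrightarrow> w (- x) = - w x"
  and Weyl_scaleR: "w \<in> W \<Longrightarrow> w (c *\<^sub>R x) = c *\<^sub>R w x"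
  and Weyl_diff: "w \<in> W \<Longrightarrow> w (x - y) = w x - w y"
  using Weyl_linear[of w] by (simp_all add: linear_neg linear_scale linear_diff)

lemma height_linear_image:
  assumes "w \<in> W"
  shows "height (w v) = (\<Sum>\<delta>\<in>\<Delta>. coeff \<delta> v * height (w \<delta>))"
proof -
  have "linear height" by (rule linearI) (simp_all add: height_add height_scaleR)
  then have "linear (height \<circ> w)" using linear_compose Weyl_linear assms by blast
  then have "(height \<circ> w) (\<Sum>\<delta>\<in>\<Delta>. coeff \<delta> v *\<^sub>R \<delta>) = (\<Sum>\<delta>\<in>\<Delta>. coeff \<delta> v * height (w \<delta>))"
    by (simp add: linear_sum linear_scale del: o_apply) (simp add: assms height_scaleR Weyl_scaleR)
  then show ?thesis by (simp add: sum_coeff)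
qed

lemma Weyl_eq_iff: "w \<in> W \<Longrightarrow> w x = w y \<longleftrightarrow> x = y"
  using Weyl_inverse by metis

lemma Weyl_root: "w \<in> W \<Longrightarrow> \<beta> \<in> \<Phi> \<Longrightarrow> w \<beta> \<in> \<Phi>"
proof -
  assume "w \<in> W" "\<beta> \<in> \<Phi>"
  then have "\<forall>\<beta>\<in>\<Phi>. w \<beta> \<in> \<Phi>"
    unfolding weyl_group_def by (induction rule: refl_group_induct) (auto simp: reflection_root)
  then show ?thesis using \<open>\<beta> \<in> \<Phi>\<close> by blast
qed

lemma Weyl_coroot: "w \<in> W \<Longrightarrow> coroot (w \<beta>) = w (coroot \<beta>)"
  by (simp add: coroot_def Weyl_inner Weyl_scaleR)

lemma Weyl_pairing: "w \<in> W \<Longrightarrow> coroot (w \<beta>) \<bullet> w x = coroot \<beta> \<bullet> x"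
  by (simp add: Weyl_coroot Weyl_inner)

lemma Weyl_reflection_commute: "w \<in> W \<Longrightarrow> w (reflection \<beta> x) = reflection (w \<beta>) (w x)"
  by (simp add: reflection_def Weyl_pairing Weyl_diff Weyl_scaleR)

lemma finite_Weyl: "finite W"
proof (rule inj_on_finite)
  show "finite (\<Phi> \<rightarrow>\<^sub>E \<Phi>)" using finite_roots by (simp add: finite_PiE)
  show "(\<lambda>w. restrict w \<Phi>) ` W \<subseteq> \<Phi> \<rightarrow>\<^sub>E \<Phi>" using Weyl_root by auto
  show "inj_on (\<lambda>w. restrict w \<Phi>) W"
  proof (rule inj_onI)
    fix v w assume vw: "v \<in> W" "w \<in> W" "restrict v \<Phi> = restrict w \<Phi>"
    have span: "span \<Phi> = UNIV" using root_system unfolding root_system_def by blast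
    show "v = w"
    proof
      fix x
      show "v x = w x"
        using linear_eq_on[of v w x \<Phi>] vw Weyl_linear span by (metis UNIV_I restrict_apply')
    qed
  qed
qed

text \<open>
  A positive root has positive inner product with itself, hence with some simple root \<open>\<alpha>\<close>, and
  the reflection in \<open>\<alpha>\<close> lowers its height. So every root can be moved to a simple one by simple
  reflections.
\<close>

lemma height_descent:
  assumes "\<beta> \<in> pos" "\<beta> \<notin> \<Delta>"
  obtains \<alpha> where "\<alpha> \<in> \<Delta>" "reflection \<alpha> \<beta> \<in> pos" "height (reflection \<alpha> \<beta>) \<le> height \<beta> - 1"
proof -
  have "(\<Sum>\<delta>\<in>\<Delta>. coeff \<delta> \<beta> * (\<delta> \<bullet> \<beta>)) = \<beta> \<bullet> \<beta>"
    using arg_cong[OF sum_coeff[of \<beta>], of "\<lambda>v. v \<bullet> \<beta>"] by (simp add: inner_sum_left)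
  also have "\<dots> > 0" using pos_nonzero[OF assms(1)] by simp
  finally have "\<exists>\<alpha>\<in>\<Delta>. coeff \<alpha> \<beta> * (\<alpha> \<bullet> \<beta>) > 0"
    by (metis (no_types, lifting) not_less sum_nonpos)
  then obtain \<alpha> where \<alpha>: "\<alpha> \<in> \<Delta>" "\<alpha> \<bullet> \<beta> > 0"
    using coeff_pos_nonneg[OF _ assms(1)] by (metis not_less zero_less_mult_iff)
  have "coroot \<alpha> \<bullet> \<beta> > 0" using \<alpha> pos_nonzero[OF simple_pos] by (simp add: coroot_def)
  moreover have "coroot \<alpha> \<bullet> \<beta> \<in> \<int>" using \<alpha> assms pos_root simple_subset pairing_integral by blast
  ultimately have "coroot \<alpha> \<bullet> \<beta> \<ge> 1" by (metis Ints_cases of_int_0_less_iff of_int_1_le_iff int_one_le_iff_zero_less)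
  then have "height (reflection \<alpha> \<beta>) \<le> height \<beta> - 1"
    using \<alpha> by (simp add: reflection_def height_diff height_scaleR height_simple)
  moreover have "reflection \<alpha> \<beta> \<in> pos" using simple_reflection_pos \<alpha>(1) assms by blast
  ultimately show ?thesis using that \<alpha>(1) by blast
qed

lemma pos_root_induct [consumes 1, case_names simple step]:
  assumes "\<beta> \<in> pos"
    and simple: "\<And>\<beta>. \<beta> \<in> \<Delta> \<Longrightarrow> P \<beta>"
    and step: "\<And>\<alpha> \<beta>. \<alpha> \<in> \<Delta> \<Longrightarrow> \<beta> \<in> pos \<Longrightarrow> P \<beta> \<Longrightarrow> P (reflection \<alpha> \<beta>)"
  shows "P \<beta>"
  using assms(1)
proof (induction "nat \<lfloor>height \<beta>\<rfloor>" arbitrary: \<beta> rule: less_induct)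
  case less
  show ?case
  proof (cases "\<beta> \<in> \<Delta>")
    case False
    then obtain \<alpha> where \<alpha>: "\<alpha> \<in> \<Delta>" "reflection \<alpha> \<beta> \<in> pos" "height (reflection \<alpha> \<beta>) \<le> height \<beta> - 1"
      using height_descent less.prems by blast
    have "0 < height (reflection \<alpha> \<beta>)" using \<alpha>(2) height_pos by blast
    then have "nat \<lfloor>height (reflection \<alpha> \<beta>)\<rfloor> < nat \<lfloor>height \<beta>\<rfloor>" using \<alpha>(3) by linarith
    then have "P (reflection \<alpha> \<beta>)" using less.hyps \<alpha>(2) by blast
    then show ?thesis using step[OF \<alpha>(1,2)] by simp
  qed (rule simple)
qed

lemma Weyl_generated_by_simple: "W = refl_group \<Delta>"
proof
  show "refl_group \<Delta> \<subseteq> W" unfolding weyl_group_def by (rule refl_group_mono[OF simple_subset])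
  have pos: "reflection \<beta> \<in> refl_group \<Delta>" if "\<beta> \<in> pos" for \<beta>
    using that
  proof (induction rule: pos_root_induct)
    case (step \<alpha> \<beta>)
    have "reflection \<alpha> \<in> refl_group \<Delta>" using step reflection_in_refl_group by blast
    then have "reflection \<alpha> \<circ> reflection \<beta> \<circ> reflection \<alpha> \<in> refl_group \<Delta>"
      using step refl_group_comp by blast
    moreover have "reflection \<alpha> \<circ> reflection \<beta> \<circ> reflection \<alpha> = reflection (reflection \<alpha> \<beta>)"
      using Weyl_reflection_commute[of "reflection \<alpha>" \<beta>] Weyl_reflection step(1) simple_subset
      by (auto simp: fun_eq_iff)
    ultimately show ?case by simp
  qed (rule reflection_in_refl_group)
  have "reflection \<beta> \<in> refl_group \<Delta>" if "\<beta> \<in> \<Phi>" for \<beta>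
    using pos[of \<beta>] pos[of "- \<beta>"] root_pos_or_neg[OF that] by (auto simp: reflection_uminus)
  then have "refl_prod \<beta>s \<in> refl_group \<Delta>" if "\<beta>s \<in> lists \<Phi>" for \<beta>s
    using that by (induction \<beta>s) (auto simp del: refl_prod_Nil simp: id_in_refl_group
        refl_group_comp refl_prod_def[of "[]"])
  then show "W \<subseteq> refl_group \<Delta>" unfolding weyl_group_def refl_group_def[of \<Phi>] by blast
qed

section \<open>Counting inversions\<close>

definition sign :: "'a \<Rightarrow> real" where "sign \<beta> = (if \<beta> \<in> pos then 1 else - 1)"

definition flipped :: "'a \<Rightarrow> 'a set" where "flipped \<gamma> = {\<epsilon> \<in> pos. reflection \<gamma> \<epsilon> \<notin> pos}"

definition inv_count :: "('a \<Rightarrow> 'a) \<Rightarrow> nat" where "inv_count w = card {\<epsilon> \<in> pos. w \<epsilon> \<notin> pos}"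

abbreviation rho_pairing :: "'a \<Rightarrow> real" where
  "rho_pairing \<gamma> \<equiv> coroot \<gamma> \<bullet> (2 *\<^sub>R weyl_vector \<Phi> \<Delta>)"

lemma sign_uminus: "\<beta> \<in> \<Phi> \<Longrightarrow> sign (- \<beta>) = - sign \<beta>"
  by (simp add: sign_def uminus_pos_iff)

lemma finite_flipped: "finite (flipped \<gamma>)"
  using finite_pos by (simp add: flipped_def)

lemma sum_sign: "(\<Sum>\<epsilon>\<in>pos. sign (w \<epsilon>)) = real (card pos) - 2 * real (inv_count w)"
proof -
  have "(\<Sum>\<epsilon>\<in>pos. sign (w \<epsilon>)) = (\<Sum>\<epsilon>\<in>pos. 1 - 2 * (if w \<epsilon> \<notin> pos then 1 else 0))"
    by (intro sum.cong) (auto simp: sign_def)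
  also have "\<dots> = real (card pos) - 2 * (\<Sum>\<epsilon>\<in>pos. if w \<epsilon> \<notin> pos then 1 else 0)"
    by (simp add: sum_subtractf sum_distrib_left)
  also have "(\<Sum>\<epsilon>\<in>pos. if w \<epsilon> \<notin> pos then 1 else 0) = real (inv_count w)"
    unfolding inv_count_def using finite_pos by (simp add: sum.If_cases Collect_conj_eq)
  finally show ?thesis .
qed

text \<open>
  The reflection in \<open>\<gamma>\<close> permutes the positive roots that it does not flip, and the negated
  reflection permutes the flipped ones, so that an odd function changes its sum only on the latter.
  With the sign of \<open>w\<close> this computes the change of length along an edge, with the pairing itself
  the quantum shift \<open>\<langle>\<gamma>\<^sup>\<vee>, 2\<rho>\<rangle>\<close>; both become sums over the same set.
\<close>

lemma flipped_uminus_reflection: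
  assumes "\<gamma> \<in> \<Phi>" "\<epsilon> \<in> flipped \<gamma>"
  shows "- reflection \<gamma> \<epsilon> \<in> flipped \<gamma>"
proof -
  have "\<epsilon> \<in> pos" "reflection \<gamma> \<epsilon> \<in> \<Phi>" "reflection \<gamma> \<epsilon> \<notin> pos"
    using assms reflection_root pos_root by (auto simp: flipped_def)
  moreover have "reflection \<gamma> (- reflection \<gamma> \<epsilon>) = - \<epsilon>"
    by (simp add: linear_neg[OF linear_reflection])
  ultimately show ?thesis using pos_root[of \<epsilon>] by (simp add: flipped_def uminus_pos_iff)
qed

lemma sum_pos_reflection:
  fixes f :: "'a \<Rightarrow> real"
  assumes \<gamma>: "\<gamma> \<in> \<Phi>" and odd: "\<And>\<beta>. \<beta> \<in> \<Phi> \<Longrightarrow> f (- \<beta>) = - f \<beta>"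
  shows "(\<Sum>\<epsilon>\<in>pos. f (reflection \<gamma> \<epsilon>)) = (\<Sum>\<epsilon>\<in>pos. f \<epsilon>) - 2 * (\<Sum>\<epsilon>\<in>flipped \<gamma>. f \<epsilon>)"
proof -
  have split: "(\<Sum>\<epsilon>\<in>pos. g \<epsilon>) = (\<Sum>\<epsilon>\<in>pos - flipped \<gamma>. g \<epsilon>) + (\<Sum>\<epsilon>\<in>flipped \<gamma>. g \<epsilon>)"
    for g :: "'a \<Rightarrow> real"
    by (rule sum.subset_diff[OF _ finite_pos]) (auto simp: flipped_def)
  have kept: "(\<Sum>\<epsilon>\<in>pos - flipped \<gamma>. f (reflection \<gamma> \<epsilon>)) = (\<Sum>\<epsilon>\<in>pos - flipped \<gamma>. f \<epsilon>)"
    by (rule sum.reindex_bij_witness[of _ "reflection \<gamma>" "reflection \<gamma>"]) (auto simp: flipped_def)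
  have "(\<Sum>\<epsilon>\<in>flipped \<gamma>. f (reflection \<gamma> \<epsilon>)) = (\<Sum>\<epsilon>\<in>flipped \<gamma>. - f \<epsilon>)"
  proof (rule sum.reindex_bij_witness[of _ "\<lambda>\<epsilon>. - reflection \<gamma> \<epsilon>" "\<lambda>\<epsilon>. - reflection \<gamma> \<epsilon>"])
    fix \<epsilon> assume \<epsilon>: "\<epsilon> \<in> flipped \<gamma>"
    have *: "- reflection \<gamma> (- reflection \<gamma> \<epsilon>) = \<epsilon>" by (simp add: linear_neg[OF linear_reflection])
    then show "- reflection \<gamma> (- reflection \<gamma> \<epsilon>) = \<epsilon>" "- reflection \<gamma> (- reflection \<gamma> \<epsilon>) = \<epsilon>"
      by simp_all
    show "- reflection \<gamma> \<epsilon> \<in> flipped \<gamma>" "- reflection \<gamma> \<epsilon> \<in> flipped \<gamma>"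
      using flipped_uminus_reflection[OF \<gamma> \<epsilon>] by simp_all
    have "reflection \<gamma> \<epsilon> \<in> \<Phi>" using \<epsilon> \<gamma> reflection_root pos_root by (auto simp: flipped_def)
    then show "- f (- reflection \<gamma> \<epsilon>) = f (reflection \<gamma> \<epsilon>)" using odd by simp
  qed
  then show ?thesis unfolding split[of "\<lambda>\<epsilon>. f (reflection \<gamma> \<epsilon>)"] split[of f] kept
    by (simp add: sum_negf)
qed

lemma inv_count_reflection:
  assumes "w \<in> W" "\<gamma> \<in> \<Phi>"
  shows "real (inv_count (w \<circ> reflection \<gamma>)) = inv_count w + (\<Sum>\<epsilon>\<in>flipped \<gamma>. sign (w \<epsilon>))"
proof -
  have "(\<Sum>\<epsilon>\<in>pos. sign (w (reflection \<gamma> \<epsilon>)))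
      = (\<Sum>\<epsilon>\<in>pos. sign (w \<epsilon>)) - 2 * (\<Sum>\<epsilon>\<in>flipped \<gamma>. sign (w \<epsilon>))"
    using assms
    by (intro sum_pos_reflection[of \<gamma> "\<lambda>\<epsilon>. sign (w \<epsilon>)"])
      (simp_all add: Weyl_uminus sign_uminus Weyl_root)
  then show ?thesis using sum_sign[of w] sum_sign[of "w \<circ> reflection \<gamma>"] by simp
qed

lemma rho_pairing_eq:
  assumes "\<gamma> \<in> \<Phi>"
  shows "rho_pairing \<gamma> = (\<Sum>\<epsilon>\<in>flipped \<gamma>. coroot \<gamma> \<bullet> \<epsilon>)"
proof -
  have "coroot \<gamma> \<bullet> \<gamma> = 2" using assms zero_not_root coroot_inner_self by metis
  then have "coroot \<gamma> \<bullet> reflection \<gamma> \<epsilon> = - (coroot \<gamma> \<bullet> \<epsilon>)" for \<epsilon>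
    by (simp add: reflection_def inner_diff_right)
  then have "(\<Sum>\<epsilon>\<in>pos. coroot \<gamma> \<bullet> \<epsilon>) = (\<Sum>\<epsilon>\<in>flipped \<gamma>. coroot \<gamma> \<bullet> \<epsilon>)"
    using sum_pos_reflection[OF assms, of "\<lambda>\<epsilon>. coroot \<gamma> \<bullet> \<epsilon>"] by (simp add: sum_negf)
  then show ?thesis by (simp add: weyl_vector_def inner_sum_right)
qed

lemma flipped_pairing:
  assumes "\<gamma> \<in> pos" "\<epsilon> \<in> flipped \<gamma>"
  shows "1 \<le> coroot \<gamma> \<bullet> \<epsilon>"
proof -
  have \<epsilon>: "\<epsilon> \<in> pos" "reflection \<gamma> \<epsilon> \<notin> pos" using assms by (auto simp: flipped_def)
  then have "height (reflection \<gamma> \<epsilon>) < 0"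
    by (intro neg_height reflection_root pos_root assms(1))
  then have "(coroot \<gamma> \<bullet> \<epsilon>) * height \<gamma> > 0"
    using height_pos[OF \<epsilon>(1)] by (simp add: reflection_def height_diff height_scaleR)
  then have "coroot \<gamma> \<bullet> \<epsilon> > 0" using height_pos[OF assms(1)] by (simp add: zero_less_mult_iff)
  moreover have "coroot \<gamma> \<bullet> \<epsilon> \<in> \<int>" using assms \<epsilon> pos_root pairing_integral by blast
  ultimately show ?thesis
    by (metis Ints_cases of_int_0_less_iff of_int_1_le_iff int_one_le_iff_zero_less)
qed

lemma flipped_self: "\<gamma> \<in> pos \<Longrightarrow> \<gamma> \<in> flipped \<gamma>"
  using reflection_self[OF pos_nonzero] pos_root by (auto simp: flipped_def uminus_pos_iff)

lemma flipped_simple: "\<alpha> \<in> \<Delta> \<Longrightarrow> flipped \<alpha> = {\<alpha>}"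
  using simple_reflection_pos[of \<alpha>] flipped_self[OF simple_pos, of \<alpha>] by (auto simp: flipped_def)

text \<open>
  The quantum condition says that the sum of \<open>sign (w \<epsilon>) + \<langle>\<gamma>\<^sup>\<vee>, \<epsilon>\<rangle>\<close> over the flipped roots
  is 1. All these terms are nonnegative and the one for \<open>\<gamma>\<close> itself is 1 or 3.
\<close>

lemma quantum_step_iff:
  assumes w: "w \<in> W" and \<gamma>: "\<gamma> \<in> pos"
  shows "real (inv_count (w \<circ> reflection \<gamma>)) = inv_count w + 1 - rho_pairing \<gamma>
    \<longleftrightarrow> w \<gamma> \<notin> pos \<and> (\<forall>\<epsilon>\<in>flipped \<gamma> - {\<gamma>}. w \<epsilon> \<notin> pos \<and> coroot \<gamma> \<bullet> \<epsilon> = 1)"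
proof -
  let ?t = "\<lambda>\<epsilon>. sign (w \<epsilon>) + coroot \<gamma> \<bullet> \<epsilon>"
  have \<gamma>': "\<gamma> \<in> \<Phi>" using pos_root \<gamma> by blast
  have nonneg: "0 \<le> ?t \<epsilon>" if "\<epsilon> \<in> flipped \<gamma>" for \<epsilon>
    using flipped_pairing[OF \<gamma> that] by (simp add: sign_def)
  have rest: "0 \<le> sum ?t (flipped \<gamma> - {\<gamma>})" using nonneg by (intro sum_nonneg) auto
  have split: "sum ?t (flipped \<gamma>) = ?t \<gamma> + sum ?t (flipped \<gamma> - {\<gamma>})"
    using flipped_self[OF \<gamma>] finite_flipped by (simp add: sum.remove)
  have self: "?t \<gamma> = sign (w \<gamma>) + 2" using coroot_inner_self[OF pos_nonzero[OF \<gamma>]] by simp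
  have term_zero: "?t \<epsilon> = 0 \<longleftrightarrow> w \<epsilon> \<notin> pos \<and> coroot \<gamma> \<bullet> \<epsilon> = 1" if "\<epsilon> \<in> flipped \<gamma>" for \<epsilon>
    using flipped_pairing[OF \<gamma> that] by (simp add: sign_def)
  have "real (inv_count (w \<circ> reflection \<gamma>)) = inv_count w + 1 - rho_pairing \<gamma>
      \<longleftrightarrow> sum ?t (flipped \<gamma>) = 1"
    unfolding inv_count_reflection[OF w \<gamma>'] rho_pairing_eq[OF \<gamma>'] sum.distrib by linarith
  also have "\<dots> \<longleftrightarrow> w \<gamma> \<notin> pos \<and> sum ?t (flipped \<gamma> - {\<gamma>}) = 0"
    unfolding split self using rest by (auto simp: sign_def)
  also have "sum ?t (flipped \<gamma> - {\<gamma>}) = 0 \<longleftrightarrow> (\<forall>\<epsilon>\<in>flipped \<gamma> - {\<gamma>}. ?t \<epsilon> = 0)"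
    using nonneg finite_flipped by (intro sum_nonneg_eq_0_iff) auto
  also have "(\<forall>\<epsilon>\<in>flipped \<gamma> - {\<gamma>}. ?t \<epsilon> = 0)
      \<longleftrightarrow> (\<forall>\<epsilon>\<in>flipped \<gamma> - {\<gamma>}. w \<epsilon> \<notin> pos \<and> coroot \<gamma> \<bullet> \<epsilon> = 1)"
    using term_zero by (intro ball_cong) auto
  finally show ?thesis .
qed

text \<open>
  A flipped root \<open>\<epsilon>\<close> and its partner \<open>- r\<^sub>\<gamma> \<epsilon>\<close> add up to a positive multiple of \<open>\<gamma>\<close>. So if
  \<open>w \<gamma>\<close> is positive, \<open>w\<close> cannot make both negative, and no pair contributes a negative amount to
  the change of length, while \<open>\<gamma>\<close> alone contributes 1. In a Bruhat step the other pairs must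
  therefore contribute 0, that is, consist of opposite signs.
\<close>

lemma Bruhat_step:
  assumes w: "w \<in> W" and \<gamma>: "\<gamma> \<in> pos"
    and step: "inv_count (w \<circ> reflection \<gamma>) = inv_count w + 1"
  shows "w \<gamma> \<in> pos"
    and "\<epsilon> \<in> flipped \<gamma> \<Longrightarrow> \<epsilon> \<noteq> \<gamma> \<Longrightarrow> w \<epsilon> \<in> pos \<Longrightarrow> - w (reflection \<gamma> \<epsilon>) \<notin> pos"
proof -
  have \<gamma>': "\<gamma> \<in> \<Phi>" using pos_root \<gamma> by blast
  \<comment> \<open>Each pair is counted twice, once from either member.\<close>
  let ?p = "\<lambda>\<epsilon>. sign (w \<epsilon>) + sign (- w (reflection \<gamma> \<epsilon>))"
  have "(\<Sum>\<epsilon>\<in>flipped \<gamma>. sign (- w (reflection \<gamma> \<epsilon>))) = (\<Sum>\<epsilon>\<in>flipped \<gamma>. sign (w \<epsilon>))"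
    using flipped_uminus_reflection[OF \<gamma>'] w
    by (intro sum.reindex_bij_witness[of _ "\<lambda>\<epsilon>. - reflection \<gamma> \<epsilon>" "\<lambda>\<epsilon>. - reflection \<gamma> \<epsilon>"])
      (auto simp: linear_neg[OF linear_reflection] Weyl_uminus)
  then have "sum ?p (flipped \<gamma>) = 2"
    using inv_count_reflection[OF w \<gamma>'] step by (simp add: sum.distrib)
  moreover have "sum ?p (flipped \<gamma>) = ?p \<gamma> + sum ?p (flipped \<gamma> - {\<gamma>})"
    using flipped_self[OF \<gamma>] finite_flipped by (simp add: sum.remove)
  moreover have "?p \<gamma> = 2 * sign (w \<gamma>)"
    using w reflection_self[OF pos_nonzero[OF \<gamma>]] by (simp add: Weyl_uminus)
  ultimately have total: "2 * sign (w \<gamma>) + sum ?p (flipped \<gamma> - {\<gamma>}) = 2" by simp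
  have pair: "height (w \<epsilon>) + height (- w (reflection \<gamma> \<epsilon>)) = (coroot \<gamma> \<bullet> \<epsilon>) * height (w \<gamma>)"
    and pair_pos: "0 < coroot \<gamma> \<bullet> \<epsilon>"
    and roots: "w \<epsilon> \<in> \<Phi>" "- w (reflection \<gamma> \<epsilon>) \<in> \<Phi>" if "\<epsilon> \<in> flipped \<gamma>" for \<epsilon>
  proof -
    show "height (w \<epsilon>) + height (- w (reflection \<gamma> \<epsilon>)) = (coroot \<gamma> \<bullet> \<epsilon>) * height (w \<gamma>)"
      using w by (simp add: reflection_def Weyl_diff Weyl_scaleR height_uminus height_diff height_scaleR)
    show "0 < coroot \<gamma> \<bullet> \<epsilon>" using flipped_pairing[OF \<gamma> that] by simp
    show "w \<epsilon> \<in> \<Phi>" "- w (reflection \<gamma> \<epsilon>) \<in> \<Phi>"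
      using that pos_root by (auto simp: flipped_def intro!: Weyl_root[OF w] uminus_root reflection_root[OF \<gamma>'])
  qed
  show pos: "w \<gamma> \<in> pos"
  proof (rule ccontr)
    assume neg: "w \<gamma> \<notin> pos"
    have "height (w \<gamma>) \<le> 0" using neg neg_height Weyl_root[OF w \<gamma>'] by fastforce
    then have "height (w \<epsilon>) + height (- w (reflection \<gamma> \<epsilon>)) \<le> 0" if "\<epsilon> \<in> flipped \<gamma>" for \<epsilon>
      using pair[OF that] pair_pos[OF that] by (simp add: mult_nonneg_nonpos)
    then have "?p \<epsilon> \<le> 0" if "\<epsilon> \<in> flipped \<gamma>" for \<epsilon>
      using that height_pos[of "w \<epsilon>"] height_pos[of "- w (reflection \<gamma> \<epsilon>)"]
      unfolding sign_def by fastforce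
    then have "sum ?p (flipped \<gamma> - {\<gamma>}) \<le> 0" by (intro sum_nonpos) auto
    then show False using total neg by (simp add: sign_def)
  qed
  have "0 \<le> ?p \<epsilon>" if "\<epsilon> \<in> flipped \<gamma>" for \<epsilon>
  proof -
    have "0 < height (w \<epsilon>) + height (- w (reflection \<gamma> \<epsilon>))"
      using pair[OF that] pair_pos[OF that] height_pos[OF pos] by simp
    then have "w \<epsilon> \<in> pos \<or> - w (reflection \<gamma> \<epsilon>) \<in> pos"
      using roots[OF that] pos_iff_height[of "w \<epsilon>"] pos_iff_height[of "- w (reflection \<gamma> \<epsilon>)"] by linarith
    then show ?thesis by (auto simp: sign_def)
  qed
  moreover have "sum ?p (flipped \<gamma> - {\<gamma>}) = 0" using total pos by (simp add: sign_def)
  ultimately have zero: "\<forall>\<epsilon>\<in>flipped \<gamma> - {\<gamma>}. ?p \<epsilon> = 0"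
    using sum_nonneg_eq_0_iff[of "flipped \<gamma> - {\<gamma>}" ?p] finite_flipped by auto
  show "- w (reflection \<gamma> \<epsilon>) \<notin> pos" if "\<epsilon> \<in> flipped \<gamma>" "\<epsilon> \<noteq> \<gamma>" "w \<epsilon> \<in> pos"
    using zero that by (auto simp: sign_def split: if_splits)
qed

section \<open>Length as the number of inversions\<close>

lemma inv_count_simple:
  assumes "w \<in> W" "\<alpha> \<in> \<Delta>"
  shows "real (inv_count (w \<circ> reflection \<alpha>)) = inv_count w + sign (w \<alpha>)"
  using inv_count_reflection[of w \<alpha>] assms simple_subset flipped_simple by auto

lemma inv_count_id: "inv_count id = 0"
  by (simp add: inv_count_def)

lemma refl_prod_Weyl: "\<alpha>s \<in> lists \<Delta> \<Longrightarrow> refl_prod \<alpha>s \<in> W"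
  unfolding Weyl_generated_by_simple refl_group_def by blast

text \<open>
  The exchange condition: when the letters act on \<open>\<alpha>\<close> from the right end of the word, the
  first letter that makes the result negative can be removed.
\<close>

lemma exchange:
  assumes "\<alpha>s \<in> lists \<Delta>" "\<alpha> \<in> \<Delta>" "refl_prod \<alpha>s \<alpha> \<notin> pos"
  shows "\<exists>\<beta>s\<in>lists \<Delta>. Suc (length \<beta>s) = length \<alpha>s
    \<and> refl_prod \<beta>s = refl_prod \<alpha>s \<circ> reflection \<alpha>"
  using assms
proof (induction \<alpha>s)
  case Nil
  then show ?case using simple_pos by simp
next
  case (Cons \<beta> \<alpha>s)
  then have in_lists: "\<beta> \<in> \<Delta>" "\<alpha>s \<in> lists \<Delta>" by auto
  show ?case
  proof (cases "refl_prod \<alpha>s \<alpha> \<in> pos")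
    case False
    then obtain \<beta>s where "\<beta>s \<in> lists \<Delta>" "Suc (length \<beta>s) = length \<alpha>s"
      "refl_prod \<beta>s = refl_prod \<alpha>s \<circ> reflection \<alpha>"
      using Cons.IH[OF \<open>\<alpha> \<in> \<Delta>\<close>] by blast
    then show ?thesis using in_lists(1) by (intro bexI[of _ "\<beta> # \<beta>s"]) (simp_all add: comp_assoc)
  next
    case True
    then have "refl_prod \<alpha>s \<alpha> = \<beta>"
      using Cons.prems(2) simple_reflection_pos[OF in_lists(1), of "refl_prod \<alpha>s \<alpha>"] by auto
    then have "refl_prod \<alpha>s = refl_prod (\<beta> # \<alpha>s) \<circ> reflection \<alpha>"
      using Weyl_reflection_commute[OF refl_prod_Weyl[OF in_lists(2)], of \<alpha>]
      by (intro ext) simp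
    then show ?thesis using in_lists(2) by (metis length_Cons)
  qed
qed

lemma refl_prod_no_inversions:
  assumes "\<alpha>s \<in> lists \<Delta>" "inv_count (refl_prod \<alpha>s) = 0"
  shows "refl_prod \<alpha>s = id"
  using assms
proof (induction "length \<alpha>s" arbitrary: \<alpha>s rule: less_induct)
  case less
  show ?case
  proof (cases \<alpha>s rule: rev_cases)
    case (snoc \<beta>s \<alpha>)
    have in_lists: "\<beta>s \<in> lists \<Delta>" "\<alpha> \<in> \<Delta>" using less.prems snoc by auto
    have comp: "refl_prod \<alpha>s = refl_prod \<beta>s \<circ> reflection \<alpha>"
      unfolding snoc refl_prod_snoc ..
    have "refl_prod \<alpha>s \<alpha> \<in> pos"
      using less.prems(2) finite_pos simple_pos[OF in_lists(2)] by (auto simp: inv_count_def)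
    then have "- refl_prod \<beta>s \<alpha> \<in> pos"
      using comp reflection_self[OF pos_nonzero[OF simple_pos[OF in_lists(2)]]]
        Weyl_uminus[OF refl_prod_Weyl[OF in_lists(1)]] by simp
    then have "refl_prod \<beta>s \<alpha> \<notin> pos"
      using height_pos[of "refl_prod \<beta>s \<alpha>"] height_pos[of "- refl_prod \<beta>s \<alpha>"]
      by (auto simp: height_uminus)
    then obtain \<beta>s' where "\<beta>s' \<in> lists \<Delta>" "Suc (length \<beta>s') = length \<beta>s"
      "refl_prod \<beta>s' = refl_prod \<beta>s \<circ> reflection \<alpha>"
      using exchange in_lists by blast
    then show ?thesis using less.hyps[of \<beta>s'] less.prems comp snoc by simp
  qed simp
qed

lemma no_inversions_id:
  assumes "w \<in> W" "inv_count w = 0"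
  shows "w = id"
proof -
  obtain \<alpha>s where "\<alpha>s \<in> lists \<Delta>" "w = refl_prod \<alpha>s"
    using assms(1) unfolding Weyl_generated_by_simple refl_group_def by blast
  then show ?thesis using refl_prod_no_inversions assms(2) by simp
qed

lemma descent_exists:
  assumes "w \<in> W" "w \<noteq> id"
  obtains \<alpha> where "\<alpha> \<in> \<Delta>" "w \<alpha> \<notin> pos"
proof -
  have "inv_count w \<noteq> 0" using no_inversions_id assms by blast
  then obtain \<epsilon> where \<epsilon>: "\<epsilon> \<in> pos" "w \<epsilon> \<notin> pos"
    unfolding inv_count_def by (metis (mono_tags, lifting) card.empty empty_Collect_eq)
  have "\<exists>\<alpha>\<in>\<Delta>. w \<alpha> \<notin> pos"
  proof (rule ccontr)
    assume "\<not> ?thesis"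
    then have simple: "0 < height (w \<delta>)" if "\<delta> \<in> \<Delta>" for \<delta> using that height_pos by blast
    have "height (w \<epsilon>) = (\<Sum>\<delta>\<in>\<Delta>. coeff \<delta> \<epsilon> * height (w \<delta>))"
      by (rule height_linear_image[OF assms(1)])
    also have "\<dots> \<ge> 0" using simple coeff_pos_nonneg[OF _ \<epsilon>(1)] by (intro sum_nonneg) (simp add: less_imp_le)
    finally have "0 \<le> height (w \<epsilon>)" .
    moreover have "height (w \<epsilon>) < 0"
      using \<epsilon> height_pos[of "- w \<epsilon>"] uminus_pos_iff[OF Weyl_root[OF assms(1) pos_root]]
      by (simp add: height_uminus)
    ultimately show False by simp
  qed
  then show ?thesis using that by blast
qed

text \<open>
  Each letter of a word changes the number of inversions by one, so a word has at least as many letters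
  as its product has inversions; multiplying by descents reaches the identity with just as many.
\<close>

lemma weyl_length_eq:
  assumes "w \<in> W"
  shows "weyl_length \<Delta> w = inv_count w"
proof -
  have lower: "inv_count (refl_prod \<alpha>s) \<le> length \<alpha>s" if "\<alpha>s \<in> lists \<Delta>" for \<alpha>s
    using that
  proof (induction \<alpha>s rule: rev_induct)
    case (snoc \<alpha> \<alpha>s)
    then have "real (inv_count (refl_prod \<alpha>s \<circ> reflection \<alpha>)) \<le> inv_count (refl_prod \<alpha>s) + 1"
      using inv_count_simple[OF refl_prod_Weyl] by (auto simp: sign_def)
    then show ?case
      using snoc unfolding refl_prod_snoc length_append_singleton append_in_lists_conv by linarith
  qed (simp add: inv_count_id)
  have upper: "\<exists>\<alpha>s\<in>lists \<Delta>. length \<alpha>s = inv_count w \<and> refl_prod \<alpha>s = w" if "w \<in> W" for w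
    using that
  proof (induction "inv_count w" arbitrary: w rule: less_induct)
    case less
    show ?case
    proof (cases "w = id")
      case True
      then show ?thesis by (intro bexI[of _ "[]"]) (simp_all add: inv_count_id)
    next
      case False
      then obtain \<alpha> where \<alpha>: "\<alpha> \<in> \<Delta>" "w \<alpha> \<notin> pos" using descent_exists less.prems by blast
      have w': "w \<circ> reflection \<alpha> \<in> W" using \<alpha> simple_subset less.prems Weyl_comp Weyl_reflection by blast
      have len: "inv_count w = inv_count (w \<circ> reflection \<alpha>) + 1"
        using inv_count_simple[OF less.prems \<alpha>(1)] \<alpha>(2) by (simp add: sign_def)
      then obtain \<alpha>s where \<alpha>s: "\<alpha>s \<in> lists \<Delta>" "length \<alpha>s = inv_count (w \<circ> reflection \<alpha>)"
        "refl_prod \<alpha>s = w \<circ> reflection \<alpha>"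
        using less.hyps[OF _ w'] by auto
      have "refl_prod (\<alpha>s @ [\<alpha>]) = w"
        unfolding refl_prod_snoc \<alpha>s(3) by (rule ext) simp
      then show ?thesis using \<alpha>s \<alpha>(1) len by (intro bexI[of _ "\<alpha>s @ [\<alpha>]"]) auto
    qed
  qed
  show ?thesis
    unfolding weyl_length_def
  proof (rule Least_equality)
    show "\<exists>\<alpha>s\<in>lists \<Delta>. length \<alpha>s = inv_count w \<and> refl_prod \<alpha>s = w" using upper[OF assms] .
    show "inv_count w \<le> n" if "\<exists>\<alpha>s\<in>lists \<Delta>. length \<alpha>s = n \<and> refl_prod \<alpha>s = w" for n
      using that lower by blast
  qed
qed

section \<open>Left multiplication and ascents\<close>

abbreviation QB :: "(('a \<Rightarrow> 'a) \<times> ('a \<Rightarrow> 'a)) set" where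
  "QB \<equiv> quantum_bruhat_graph \<Phi> \<Delta>"

lemma edge_iff:
  "(w, y) \<in> QB \<longleftrightarrow> w \<in> W \<and> (\<exists>\<gamma>\<in>pos. y = w \<circ> reflection \<gamma> \<and>
     (inv_count y = inv_count w + 1 \<or> real (inv_count y) = inv_count w + 1 - rho_pairing \<gamma>))"
proof -
  have "weyl_length \<Delta> (w \<circ> reflection \<gamma>) = inv_count (w \<circ> reflection \<gamma>)"
    "weyl_length \<Delta> w = inv_count w" if "w \<in> W" "\<gamma> \<in> pos" for \<gamma>
    using that by (simp_all add: weyl_length_eq Weyl_comp Weyl_reflection pos_root)
  then show ?thesis unfolding quantum_bruhat_graph_def by auto
qed

lemma edge_Weyl: "(w, y) \<in> QB \<Longrightarrow> w \<in> W \<and> y \<in> W"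
  unfolding edge_iff using Weyl_comp Weyl_reflection pos_root by blast

text \<open>
  This is positivity of \<open>w\<inverse> a\<close>, phrased without the inverse. For a simple root \<open>a\<close> it says that
  left multiplication with the reflection in \<open>a\<close> raises the length.
\<close>

definition ascent :: "'a \<Rightarrow> ('a \<Rightarrow> 'a) \<Rightarrow> bool" where "ascent a w \<longleftrightarrow> a \<in> w ` pos"

lemma ascentE:
  assumes "ascent a w"
  obtains \<gamma> where "\<gamma> \<in> pos" "w \<gamma> = a"
  using assms unfolding ascent_def by blast

lemma ascent_cases:
  assumes "w \<in> W" "a \<in> \<Phi>"
  shows "ascent (- a) w \<longleftrightarrow> \<not> ascent a w"
proof -
  obtain w' where w': "w' \<in> W" "\<And>x. w' (w x) = x" "\<And>x. w (w' x) = x"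
    using Weyl_inverse assms(1) by blast
  have "ascent b w \<longleftrightarrow> w' b \<in> pos" for b unfolding ascent_def by (metis w'(2,3) image_iff)
  then show ?thesis using w'(1) assms(2) by (simp add: Weyl_uminus uminus_pos_iff Weyl_root)
qed

lemma left_reflection:
  assumes "w \<in> W" "w \<gamma> = a \<or> w \<gamma> = - a"
  shows "reflection a \<circ> w = w \<circ> reflection \<gamma>"
proof
  fix x
  have "reflection (w \<gamma>) = reflection a" using assms(2) reflection_uminus by metis
  then show "(reflection a \<circ> w) x = (w \<circ> reflection \<gamma>) x"
    using Weyl_reflection_commute[OF assms(1)] by simp
qed

lemma ascent_left_reflection:
  assumes "w \<in> W" "a \<in> \<Phi>"
  shows "ascent a (reflection a \<circ> w) \<longleftrightarrow> ascent (- a) w"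
proof -
  have "reflection a a = - a" using assms(2) zero_not_root reflection_self by metis
  then have "a = (reflection a \<circ> w) \<gamma> \<longleftrightarrow> - a = w \<gamma>" for \<gamma>
    using reflection_involutive[of a "w \<gamma>"] by (metis comp_apply reflection_involutive)
  then show ?thesis unfolding ascent_def image_iff by (simp only:)
qed

lemma sign_simple_reflection:
  assumes "a \<in> \<Delta>" "\<beta> \<in> \<Phi>" "\<beta> \<noteq> a" "\<beta> \<noteq> - a"
  shows "sign (reflection a \<beta>) = sign \<beta>"
proof (cases "\<beta> \<in> pos")
  case True
  then show ?thesis using simple_reflection_pos assms by (simp add: sign_def)
next
  case False
  then have "- \<beta> \<in> pos" "- \<beta> \<noteq> a" using assms(2,4) by (auto simp: uminus_pos_iff)
  then have "reflection a (- \<beta>) \<in> pos" using simple_reflection_pos[OF assms(1)] by blast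
  then have "- reflection a \<beta> \<in> pos" by (simp add: linear_neg[OF linear_reflection])
  moreover have "reflection a \<beta> \<in> \<Phi>" using assms simple_subset reflection_root by blast
  ultimately show ?thesis using False by (simp add: sign_def uminus_pos_iff)
qed

text \<open>
  Left multiplication with a simple reflection affects the sign of \<open>w \<epsilon>\<close> only for the one
  positive root \<open>\<epsilon> = w\<inverse> a\<close>.
\<close>

lemma inv_count_left_simple:
  assumes w: "w \<in> W" and a: "a \<in> \<Delta>" and "ascent a w"
  shows "inv_count (reflection a \<circ> w) = inv_count w + 1"
proof -
  obtain \<gamma> where \<gamma>: "\<gamma> \<in> pos" "w \<gamma> = a" using ascentE assms(3) by blast
  have "sign (reflection a (w \<epsilon>)) = sign (w \<epsilon>)" if "\<epsilon> \<in> pos - {\<gamma>}" for \<epsilon>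
  proof (rule sign_simple_reflection[OF a])
    show "w \<epsilon> \<in> \<Phi>" "w \<epsilon> \<noteq> a" using that \<gamma> Weyl_eq_iff[OF w] Weyl_root[OF w] pos_root by auto
    have "\<epsilon> \<noteq> - \<gamma>" using that \<gamma>(1) uminus_pos_iff pos_root by auto
    then show "w \<epsilon> \<noteq> - a" using \<gamma>(2) Weyl_eq_iff[OF w] Weyl_uminus[OF w] by metis
  qed
  then have "(\<Sum>\<epsilon>\<in>pos - {\<gamma>}. sign (reflection a (w \<epsilon>))) = (\<Sum>\<epsilon>\<in>pos - {\<gamma>}. sign (w \<epsilon>))"
    by (intro sum.cong) auto
  moreover have "sign (reflection a (w \<gamma>)) = - 1" "sign (w \<gamma>) = 1"
    using \<gamma>(2) simple_pos[OF a] reflection_self[OF pos_nonzero] pos_root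
    by (auto simp: sign_def uminus_pos_iff)
  ultimately have "(\<Sum>\<epsilon>\<in>pos. sign (reflection a (w \<epsilon>))) = (\<Sum>\<epsilon>\<in>pos. sign (w \<epsilon>)) - 2"
    using sum.remove[OF finite_pos \<gamma>(1), of "\<lambda>\<epsilon>. sign (w \<epsilon>)"]
      sum.remove[OF finite_pos \<gamma>(1), of "\<lambda>\<epsilon>. sign (reflection a (w \<epsilon>))"] by simp
  then show ?thesis using sum_sign[of w] sum_sign[of "reflection a \<circ> w"] by simp
qed

text \<open>
  One of the two pairings is 1, so that a reflection produces the difference: if both were at least 2,
  then \<open>\<alpha> \<bullet> \<beta>\<close> would be at least both squared norms, and \<open>\<alpha> - \<beta>\<close> would vanish.
\<close>

lemma root_diff:
  assumes "\<alpha> \<in> \<Phi>" "\<beta> \<in> \<Phi>" "\<alpha> \<bullet> \<beta> > 0" "\<alpha> \<noteq> \<beta>"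
  shows "\<alpha> - \<beta> \<in> \<Phi>"
proof -
  have nz: "\<alpha> \<bullet> \<alpha> > 0" "\<beta> \<bullet> \<beta> > 0" using assms zero_not_root by auto
  have int: "coroot \<alpha> \<bullet> \<beta> = 1 \<or> 2 \<le> coroot \<alpha> \<bullet> \<beta>"
    if roots: "\<alpha> \<in> \<Phi>" "\<beta> \<in> \<Phi>" and "\<alpha> \<bullet> \<beta> > 0" "\<alpha> \<bullet> \<alpha> > 0" for \<alpha> \<beta>
  proof -
    obtain k where k: "coroot \<alpha> \<bullet> \<beta> = of_int k" using pairing_integral[OF roots] Ints_cases by metis
    have "coroot \<alpha> \<bullet> \<beta> > 0" using that(3,4) by (simp add: coroot_def)
    then have "k = 1 \<or> 2 \<le> k" unfolding k by linarith
    then show ?thesis unfolding k by auto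
  qed
  have "coroot \<alpha> \<bullet> \<beta> = 1 \<or> coroot \<beta> \<bullet> \<alpha> = 1"
  proof (rule ccontr)
    assume "\<not> ?thesis"
    then have "2 \<le> coroot \<alpha> \<bullet> \<beta>" "2 \<le> coroot \<beta> \<bullet> \<alpha>"
      using int assms nz inner_commute[of \<alpha> \<beta>] by metis+
    then have "\<alpha> \<bullet> \<alpha> \<le> \<alpha> \<bullet> \<beta>" "\<beta> \<bullet> \<beta> \<le> \<alpha> \<bullet> \<beta>"
      using nz by (simp_all add: coroot_def field_simps inner_commute)
    then have "(\<alpha> - \<beta>) \<bullet> (\<alpha> - \<beta>) \<le> 0" by (simp add: inner_diff_left inner_diff_right inner_commute)
    moreover have "0 < (\<alpha> - \<beta>) \<bullet> (\<alpha> - \<beta>)"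
      unfolding inner_gt_zero_iff using assms(4) by simp
    ultimately show False by linarith
  qed
  then show ?thesis
  proof
    assume "coroot \<alpha> \<bullet> \<beta> = 1"
    then have "\<beta> - \<alpha> \<in> \<Phi>" using reflection_root[OF assms(1,2)] by (simp add: reflection_def)
    then show ?thesis using uminus_root by fastforce
  next
    assume "coroot \<beta> \<bullet> \<alpha> = 1"
    then show ?thesis using reflection_root[OF assms(2,1)] by (simp add: reflection_def)
  qed
qed

end

section \<open>The highest root\<close>

locale irreducible_based_root_system = based_root_system +
  assumes irreducible: "irreducible_root_system \<Phi>"
begin

definition highest_root :: 'a where
  "highest_root = (SOME \<theta>. \<theta> \<in> pos \<and> (\<forall>\<beta>\<in>pos. height \<beta> \<le> height \<theta>))"

lemma highest_root_pos: "highest_root \<in> pos"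
  and height_le_highest: "\<beta> \<in> pos \<Longrightarrow> height \<beta> \<le> height highest_root"
proof -
  obtain \<beta>' where "\<beta>' \<in> \<Phi>" using irreducible unfolding irreducible_root_system_def by blast
  then have "pos \<noteq> {}" using root_pos_or_neg by blast
  then have "Max (height ` pos) \<in> height ` pos" using finite_pos by (intro Max_in) auto
  then obtain \<theta> where \<theta>: "\<theta> \<in> pos" "height \<theta> = Max (height ` pos)" by auto
  then have "\<theta> \<in> pos \<and> (\<forall>\<beta>\<in>pos. height \<beta> \<le> height \<theta>)" using finite_pos by simp
  then have "highest_root \<in> pos \<and> (\<forall>\<beta>\<in>pos. height \<beta> \<le> height highest_root)"
    unfolding highest_root_def by (rule someI)
  then show "highest_root \<in> pos" "\<beta> \<in> pos \<Longrightarrow> height \<beta> \<le> height highest_root" by auto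
qed

lemma highest_root_root: "highest_root \<in> \<Phi>"
  using highest_root_pos pos_root by blast

lemma height_root_le: "\<beta> \<in> \<Phi> \<Longrightarrow> height \<beta> \<le> height highest_root"
  using height_le_highest neg_height height_pos[OF highest_root_pos] by fastforce

lemma height_root_nonzero: "\<beta> \<in> \<Phi> \<Longrightarrow> height \<beta> \<noteq> 0"
  using neg_height height_pos by fastforce

text \<open>
  If the pairing \<open>k\<close> were negative, then \<open>\<theta> + \<beta>\<close> would be a root above the highest root
  \<open>\<theta>\<close>. If \<open>k \<ge> 2\<close>, then \<open>\<theta> - \<beta>\<close> is a root, so that \<open>\<beta>\<close> is strictly lower than
  \<open>\<theta>\<close>, and then \<open>k \<theta> - \<beta>\<close> would be a root above \<open>\<theta>\<close>.
\<close>

lemma highest_root_pairing: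
  assumes "\<beta> \<in> pos" "\<beta> \<noteq> highest_root"
  shows "coroot highest_root \<bullet> \<beta> = 0 \<or> coroot highest_root \<bullet> \<beta> = 1"
proof -
  let ?\<theta> = highest_root
  have \<beta>: "\<beta> \<in> \<Phi>" and \<theta>: "?\<theta> \<in> \<Phi>" using assms pos_root highest_root_root by auto
  have nz: "?\<theta> \<bullet> ?\<theta> > 0" using pos_nonzero[OF highest_root_pos] by simp
  obtain k where k: "coroot ?\<theta> \<bullet> \<beta> = of_int k" using pairing_integral[OF \<theta> \<beta>] Ints_cases by metis
  have "0 \<le> k"
  proof (rule ccontr)
    assume "\<not> ?thesis"
    then have "coroot ?\<theta> \<bullet> \<beta> < 0" using k by simp
    then have "?\<theta> \<bullet> - \<beta> > 0" using nz by (simp add: coroot_def divide_less_0_iff mult_less_0_iff)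
    moreover have "?\<theta> \<noteq> - \<beta>"
      using height_pos[OF assms(1)] height_pos[OF highest_root_pos] by (auto simp: height_uminus)
    ultimately have "?\<theta> - - \<beta> \<in> \<Phi>" using root_diff \<theta> uminus_root[OF \<beta>] by blast
    then show False using height_root_le[of "?\<theta> + \<beta>"] height_pos[OF assms(1)] by (simp add: height_add)
  qed
  moreover have "k \<le> 1"
  proof (rule ccontr)
    assume "\<not> ?thesis"
    then have k2: "(2::real) \<le> of_int k" by simp
    then have "coroot ?\<theta> \<bullet> \<beta> > 0" using k by simp
    then have "?\<theta> \<bullet> \<beta> > 0" using nz by (simp add: coroot_def zero_less_divide_iff zero_less_mult_iff)
    then have "?\<theta> - \<beta> \<in> \<Phi>" using root_diff \<theta> \<beta> assms(2) by blast
    then have "height \<beta> < height ?\<theta>"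
      using height_root_nonzero[of "?\<theta> - \<beta>"] height_le_highest[OF assms(1)] by (simp add: height_diff)
    moreover have "of_int k *\<^sub>R ?\<theta> - \<beta> \<in> \<Phi>"
      using uminus_root[OF reflection_root[OF \<theta> \<beta>]] k by (simp add: reflection_def)
    then have "of_int k * height ?\<theta> - height \<beta> \<le> height ?\<theta>"
      using height_root_le[of "of_int k *\<^sub>R ?\<theta> - \<beta>"] by (simp add: height_diff height_scaleR)
    moreover have "2 * height ?\<theta> \<le> of_int k * height ?\<theta>"
      using k2 height_pos[OF highest_root_pos] by (intro mult_right_mono) auto
    ultimately show False by linarith
  qed
  ultimately have "k = 0 \<or> k = 1" by linarith
  then show ?thesis using k by auto
qed

lemma simple_inner_nonpos:
  assumes "\<alpha> \<in> \<Delta>" "\<beta> \<in> \<Delta>" "\<alpha> \<noteq> \<beta>"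
  shows "\<alpha> \<bullet> \<beta> \<le> 0"
proof (rule ccontr)
  assume "\<not> ?thesis"
  then have "\<alpha> - \<beta> \<in> \<Phi>" using root_diff[of \<alpha> \<beta>] assms simple_subset by auto
  then show False using height_root_nonzero[of "\<alpha> - \<beta>"] assms by (simp add: height_diff height_simple)
qed

text \<open>
  A simple root outside the support of the highest root \<open>\<theta>\<close> has nonpositive inner product with each
  simple root in the support, but nonnegative inner product with \<open>\<theta>\<close>; so it is orthogonal to the
  whole support. The simple roots inside and outside then span two orthogonal subspaces that together
  contain all roots, against irreducibility.
\<close>

lemma highest_root_full_support:
  assumes "\<delta> \<in> \<Delta>"
  shows "0 < coeff \<delta> highest_root"
proof (rule ccontr)
  assume not_pos: "\<not> ?thesis"
  let ?\<theta> = highest_root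
  define I where "I = {\<alpha> \<in> \<Delta>. coeff \<alpha> ?\<theta> > 0}"
  have I: "I \<subseteq> \<Delta>" "\<delta> \<notin> I" using not_pos by (auto simp: I_def)
  have zero: "coeff \<beta> ?\<theta> = 0" if "\<beta> \<in> \<Delta> - I" for \<beta>
    using coeff_pos_nonneg[OF _ highest_root_pos, of \<beta>] that by (auto simp: I_def)
  have orth: "\<alpha> \<bullet> \<beta> = 0" if \<alpha>: "\<alpha> \<in> I" and \<beta>: "\<beta> \<in> \<Delta> - I" for \<alpha> \<beta>
  proof -
    have term_nonpos: "coeff \<epsilon> ?\<theta> * (\<epsilon> \<bullet> \<beta>) \<le> 0" if "\<epsilon> \<in> \<Delta>" for \<epsilon>
      using that \<beta> zero[OF \<beta>] simple_inner_nonpos[of \<epsilon> \<beta>] coeff_pos_nonneg[OF that highest_root_pos]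
      by (cases "\<epsilon> = \<beta>") (auto simp: mult_nonneg_nonpos)
    have sum: "?\<theta> \<bullet> \<beta> = (\<Sum>\<epsilon>\<in>\<Delta>. coeff \<epsilon> ?\<theta> * (\<epsilon> \<bullet> \<beta>))"
      using arg_cong[OF sum_coeff[of ?\<theta>], of "\<lambda>v. v \<bullet> \<beta>"] by (simp add: inner_sum_left)
    have "\<beta> \<noteq> ?\<theta>" using zero[OF \<beta>] \<beta> coeff_simple[of \<beta> \<beta>] by auto
    then have "0 \<le> coroot ?\<theta> \<bullet> \<beta>" using highest_root_pairing[of \<beta>] simple_pos \<beta> by auto
    then have "0 \<le> ?\<theta> \<bullet> \<beta>"
      using pos_nonzero[OF highest_root_pos] inner_gt_zero_iff[of ?\<theta>]
      by (auto simp: coroot_def zero_le_divide_iff zero_le_mult_iff not_le[symmetric])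
    moreover have "(\<Sum>\<epsilon>\<in>\<Delta>. coeff \<epsilon> ?\<theta> * (\<epsilon> \<bullet> \<beta>)) \<le> 0" using term_nonpos by (rule sum_nonpos)
    ultimately have "(\<Sum>\<epsilon>\<in>\<Delta>. coeff \<epsilon> ?\<theta> * (\<epsilon> \<bullet> \<beta>)) = 0" using sum by linarith
    then have "\<forall>\<epsilon>\<in>\<Delta>. coeff \<epsilon> ?\<theta> * (\<epsilon> \<bullet> \<beta>) = 0"
      using sum_nonneg_eq_0_iff[of \<Delta> "\<lambda>\<epsilon>. - (coeff \<epsilon> ?\<theta> * (\<epsilon> \<bullet> \<beta>))"] finite_simple term_nonpos
      by (simp add: sum_negf)
    then have "coeff \<alpha> ?\<theta> * (\<alpha> \<bullet> \<beta>) = 0" using \<alpha> I(1) by blast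
    then show ?thesis using \<alpha> by (simp add: I_def)
  qed
  have "I \<noteq> {}"
  proof
    assume "I = {}"
    then have "height ?\<theta> = 0" unfolding height_def using zero by (intro sum.neutral) auto
    then show False using height_pos[OF highest_root_pos] by simp
  qed
  let ?A = "\<Phi> \<inter> span I" and ?B = "\<Phi> \<inter> span (\<Delta> - I)"
  \<comment> \<open>Each half is stable under all simple reflections, which carry simple roots to all positive ones.\<close>
  have stable: "reflection \<alpha> \<beta> \<in> span K" if "\<alpha> \<in> \<Delta>" "\<beta> \<in> span K" "K = I \<or> K = \<Delta> - I" for \<alpha> \<beta> K
  proof (cases "\<alpha> \<in> K")
    case True
    then show ?thesis
      using that(2) by (simp add: reflection_def span_diff span_scale span_base)
  next
    case False
    have "\<epsilon> \<bullet> \<alpha> = 0" if "\<epsilon> \<in> K" for \<epsilon>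
      using orth[of \<epsilon> \<alpha>] orth[of \<alpha> \<epsilon>] that False \<open>\<alpha> \<in> \<Delta>\<close> \<open>K = I \<or> K = \<Delta> - I\<close>
      by (auto simp: inner_commute)
    then have "\<alpha> \<bullet> \<beta> = 0"
      using orthogonal_to_span[OF that(2), of \<alpha>] by (auto simp: orthogonal_def inner_commute)
    then show ?thesis using that(2) by (simp add: reflection_def coroot_def)
  qed
  have pos_split: "\<beta> \<in> span I \<or> \<beta> \<in> span (\<Delta> - I)" if "\<beta> \<in> pos" for \<beta>
    using that
  proof (induction rule: pos_root_induct)
    case (simple \<beta>)
    then show ?case by (cases "\<beta> \<in> I") (auto intro: span_base)
  next
    case (step \<alpha> \<beta>)
    then show ?case using stable[of \<alpha> \<beta>] by blast
  qed
  have "\<Phi> \<subseteq> ?A \<union> ?B"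
  proof
    fix \<beta> assume "\<beta> \<in> \<Phi>"
    then show "\<beta> \<in> ?A \<union> ?B"
      using pos_split[of \<beta>] pos_split[of "- \<beta>"] root_pos_or_neg[of \<beta>]
        span_neg[of "- \<beta>" I] span_neg[of "- \<beta>" "\<Delta> - I"] unfolding minus_minus by blast
  qed
  then have union: "?A \<union> ?B = \<Phi>" by blast
  have perp: "\<forall>\<alpha>\<in>?A. \<forall>\<beta>\<in>?B. \<alpha> \<bullet> \<beta> = 0"
  proof (intro ballI)
    fix \<alpha> \<beta> assume \<alpha>: "\<alpha> \<in> ?A" and \<beta>: "\<beta> \<in> ?B"
    have "\<epsilon> \<bullet> \<beta> = 0" if "\<epsilon> \<in> I" for \<epsilon>
      using orthogonal_to_span[of \<beta> "\<Delta> - I" \<epsilon>] \<beta> orth[OF that] by (auto simp: orthogonal_def)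
    then show "\<alpha> \<bullet> \<beta> = 0"
      using orthogonal_to_span[of \<alpha> I \<beta>] \<alpha> by (auto simp: orthogonal_def inner_commute)
  qed
  have disjoint: "?A \<inter> ?B = {}"
  proof (rule ccontr)
    assume "?A \<inter> ?B \<noteq> {}"
    then obtain \<beta> where "\<beta> \<in> ?A" "\<beta> \<in> ?B" by blast
    then have "\<beta> \<bullet> \<beta> = 0" using perp by blast
    then show False using \<open>\<beta> \<in> ?A\<close> zero_not_root by auto
  qed
  have nonempty: "?A \<noteq> {}" "?B \<noteq> {}"
  proof -
    obtain \<alpha> where "\<alpha> \<in> I" using \<open>I \<noteq> {}\<close> by blast
    then show "?A \<noteq> {}" using I(1) simple_subset span_base[of \<alpha> I] by blast
    show "?B \<noteq> {}" using I(2) assms simple_subset span_base[of \<delta> "\<Delta> - I"] by blast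
  qed
  have "\<exists>A B. A \<noteq> {} \<and> B \<noteq> {} \<and> A \<union> B = \<Phi> \<and> A \<inter> B = {} \<and> (\<forall>\<alpha>\<in>A. \<forall>\<beta>\<in>B. \<alpha> \<bullet> \<beta> = 0)"
    by (rule exI[of _ ?A], rule exI[of _ ?B]) (intro conjI union perp disjoint nonempty)
  then show False using irreducible unfolding irreducible_root_system_def by (elim conjE notE)
qed

section \<open>Edges under left multiplication\<close>

text \<open>
  For the negated highest root \<open>- \<theta>\<close>, which plays the role of the affine simple root, an ascent
  is a quantum edge: the flipped roots of \<open>\<gamma> = - w\<inverse> \<theta>\<close> pair positively with \<open>\<gamma>\<close>, so \<open>w\<close>
  sends them to roots that pair negatively with \<open>\<theta>\<close>. Those are negative roots, and all but
  \<open>- \<theta>\<close> itself pair to \<open>- 1\<close>.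
\<close>

lemma inv_count_left_highest:
  assumes w: "w \<in> W" and \<gamma>: "\<gamma> \<in> pos" and w\<gamma>: "w \<gamma> = - highest_root"
  shows "real (inv_count (reflection highest_root \<circ> w)) = inv_count w + 1 - rho_pairing \<gamma>"
proof -
  let ?\<theta> = highest_root
  have "w \<epsilon> \<notin> pos \<and> coroot \<gamma> \<bullet> \<epsilon> = 1" if \<epsilon>: "\<epsilon> \<in> flipped \<gamma> - {\<gamma>}" for \<epsilon>
  proof -
    have pair: "coroot \<gamma> \<bullet> \<epsilon> = coroot ?\<theta> \<bullet> - w \<epsilon>"
      using Weyl_pairing[OF w, of \<gamma> \<epsilon>] w\<gamma> by (simp add: coroot_uminus)
    have root: "w \<epsilon> \<in> \<Phi>" using \<epsilon> Weyl_root[OF w] pos_root by (auto simp: flipped_def)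
    have ne: "w \<epsilon> \<noteq> - ?\<theta>" using \<epsilon> Weyl_eq_iff[OF w, of \<epsilon> \<gamma>] unfolding w\<gamma> by blast
    have ge: "1 \<le> coroot ?\<theta> \<bullet> - w \<epsilon>" using flipped_pairing[OF \<gamma>, of \<epsilon>] \<epsilon> unfolding pair by blast
    have "w \<epsilon> \<notin> pos"
    proof
      assume "w \<epsilon> \<in> pos"
      then have "0 \<le> coroot ?\<theta> \<bullet> w \<epsilon>"
        using highest_root_pairing[of "w \<epsilon>"] coroot_inner_self[OF pos_nonzero[OF highest_root_pos]]
        by (cases "w \<epsilon> = ?\<theta>") auto
      then show False using ge by simp
    qed
    then have "- w \<epsilon> \<in> pos" using root by (simp add: uminus_pos_iff)
    moreover have "- w \<epsilon> \<noteq> ?\<theta>" using ne by (metis minus_minus)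
    ultimately have "coroot ?\<theta> \<bullet> - w \<epsilon> = 1" using highest_root_pairing[of "- w \<epsilon>"] ge by linarith
    then show ?thesis using \<open>w \<epsilon> \<notin> pos\<close> pair by simp
  qed
  moreover have "w \<gamma> \<notin> pos"
    using w\<gamma> highest_root_pos uminus_pos_iff[OF highest_root_root] by simp
  ultimately have "real (inv_count (w \<circ> reflection \<gamma>)) = inv_count w + 1 - rho_pairing \<gamma>"
    using quantum_step_iff[OF w \<gamma>] by blast
  then show ?thesis using left_reflection[OF w, of \<gamma> ?\<theta>] w\<gamma> by simp
qed

lemma inv_count_left_highest_descent:
  assumes w: "w \<in> W" and \<gamma>: "\<gamma> \<in> pos" and w\<gamma>: "w \<gamma> = highest_root"
  shows "real (inv_count (reflection highest_root \<circ> w)) = inv_count w - (1 - rho_pairing \<gamma>)"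
proof -
  let ?\<theta> = highest_root
  have w': "reflection ?\<theta> \<circ> w \<in> W" using Weyl_comp Weyl_reflection highest_root_root w by blast
  have "(reflection ?\<theta> \<circ> w) \<gamma> = - ?\<theta>"
    using w\<gamma> reflection_self[OF pos_nonzero[OF highest_root_pos]] by simp
  moreover have "reflection ?\<theta> \<circ> (reflection ?\<theta> \<circ> w) = w" by (rule ext) simp
  ultimately show ?thesis using inv_count_left_highest[OF w' \<gamma>] by simp
qed

definition affine_simple :: "'a set" where "affine_simple = insert (- highest_root) \<Delta>"

lemma affine_simple_root: "a \<in> affine_simple \<Longrightarrow> a \<in> \<Phi>"
  using simple_subset highest_root_root uminus_root by (auto simp: affine_simple_def)

lemma affine_left_Weyl: "a \<in> affine_simple \<Longrightarrow> w \<in> W \<Longrightarrow> reflection a \<circ> w \<in> W"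
  using Weyl_comp Weyl_reflection affine_simple_root by blast

lemma ascent_edge:
  assumes w: "w \<in> W" and a: "a \<in> affine_simple" and asc: "ascent a w"
  shows "(w, reflection a \<circ> w) \<in> QB"
proof -
  obtain \<gamma> where \<gamma>: "\<gamma> \<in> pos" "w \<gamma> = a" using ascentE asc by blast
  have comp: "reflection a \<circ> w = w \<circ> reflection \<gamma>" using left_reflection[OF w] \<gamma>(2) by blast
  have "inv_count (reflection a \<circ> w) = inv_count w + 1
      \<or> real (inv_count (reflection a \<circ> w)) = inv_count w + 1 - rho_pairing \<gamma>"
  proof (cases "a \<in> \<Delta>")
    case True
    then show ?thesis using inv_count_left_simple[OF w _ asc] by blast
  next
    case False
    then have "a = - highest_root" using a by (simp add: affine_simple_def)
    then show ?thesis
      using inv_count_left_highest[OF w \<gamma>(1)] \<gamma>(2) by (simp add: reflection_uminus)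
  qed
  then show ?thesis unfolding edge_iff using w \<gamma>(1) comp by auto
qed

text \<open>
  Suppose that an edge with label \<open>\<gamma>\<close> leads from an ascent to a descent, and put
  \<open>\<beta> = w\<inverse> a\<close>. Then \<open>\<beta>\<close> and its partner \<open>\<beta>' = - r\<^sub>\<gamma> \<beta>\<close> are flipped, and
  \<open>w \<beta>' = k w \<gamma> - a\<close> with \<open>k \<ge> 1\<close>. Unless \<open>\<beta> = \<gamma>\<close>, the signs that an edge imposes on
  these two roots are impossible. In a Bruhat step they are not both positive; but for simple \<open>a\<close>
  both \<open>a\<close> and \<open>k w \<gamma> - a\<close> are, and for \<open>a = - \<theta>\<close> the root \<open>k w \<gamma> + \<theta>\<close> would be
  higher than \<open>\<theta>\<close>. In a quantum step, \<open>w \<beta> = a\<close> must be negative, so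
  \<open>a = - \<theta>\<close>, and \<open>k = 1\<close>; then \<open>w \<gamma> + \<theta>\<close> must be negative as well, which would make
  \<open>- w \<gamma>\<close> higher than \<open>\<theta>\<close>.
\<close>

lemma edge_ascent_descent:
  assumes edge: "(w, y) \<in> QB" and a: "a \<in> affine_simple"
    and asc: "ascent a w" and desc: "ascent (- a) y"
  shows "y = reflection a \<circ> w"
proof -
  let ?\<theta> = highest_root
  obtain \<gamma> where w: "w \<in> W" and \<gamma>: "\<gamma> \<in> pos" and y: "y = w \<circ> reflection \<gamma>"
    and step: "inv_count y = inv_count w + 1 \<or> real (inv_count y) = inv_count w + 1 - rho_pairing \<gamma>"
    using edge edge_iff by blast
  obtain \<beta> where \<beta>: "\<beta> \<in> pos" "w \<beta> = a" using ascentE asc by blast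
  obtain \<beta>' where \<beta>': "\<beta>' \<in> pos" "y \<beta>' = - a" using ascentE desc by blast
  have "w (reflection \<gamma> \<beta>') = w (- \<beta>)" using \<beta> \<beta>' y by (simp add: Weyl_uminus[OF w])
  then have "reflection \<gamma> \<beta>' = - \<beta>" using Weyl_eq_iff[OF w] by blast
  then have partner: "reflection \<gamma> \<beta> = - \<beta>'"
    by (metis minus_minus reflection_involutive linear_neg[OF linear_reflection])
  have flip: "\<beta> \<in> flipped \<gamma>" "\<beta>' \<in> flipped \<gamma>"
    using \<beta>(1) \<beta>'(1) partner \<open>reflection \<gamma> \<beta>' = - \<beta>\<close> uminus_pos_iff[OF pos_root]
    by (simp_all add: flipped_def)
  define k where "k = coroot \<gamma> \<bullet> \<beta>"
  have k: "1 \<le> k" unfolding k_def using flipped_pairing[OF \<gamma> flip(1)] .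
  have "\<beta>' = k *\<^sub>R \<gamma> - \<beta>" using partner by (simp add: reflection_def k_def algebra_simps)
  then have w\<beta>': "w \<beta>' = k *\<^sub>R w \<gamma> - a" using \<beta>(2) w by (simp add: Weyl_diff Weyl_scaleR)
  have w\<beta>'_root: "w \<beta>' \<in> \<Phi>" using Weyl_root[OF w pos_root[OF \<beta>'(1)]] .
  have "\<beta> = \<gamma>"
  proof (rule ccontr)
    assume ne: "\<beta> \<noteq> \<gamma>"
    have ne': "\<beta>' \<noteq> \<gamma>"
      using partner reflection_self[OF pos_nonzero[OF \<gamma>]] ne by (metis reflection_involutive)
    have w\<gamma>_ne: "w \<gamma> \<noteq> a" using ne \<beta>(2) Weyl_eq_iff[OF w] by metis
    from step show False
    proof
      assume up: "inv_count y = inv_count w + 1"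
      note bruhat = Bruhat_step[OF w \<gamma> up[unfolded y]]
      show False
      proof (cases "a \<in> \<Delta>")
        case True
        obtain \<delta> where \<delta>: "\<delta> \<in> \<Delta>" "\<delta> \<noteq> a" "0 < coeff \<delta> (w \<gamma>)"
          using other_simple_coeff[OF bruhat(1) True w\<gamma>_ne] by blast
        have "0 < coeff \<delta> (w \<beta>')"
          using \<delta> k True by (simp add: w\<beta>' coeff_diff coeff_scaleR coeff_simple)
        then have "w \<beta>' \<in> pos" using pos_of_coeff[OF w\<beta>'_root \<delta>(1)] by blast
        moreover have "w \<beta> \<in> pos" using \<beta>(2) simple_pos[OF True] by simp
        ultimately show False
          using bruhat(2)[OF flip(1) ne] partner by (simp add: Weyl_uminus[OF w])
      next
        case False
        then have "a = - ?\<theta>" using a by (simp add: affine_simple_def)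
        then have "height (w \<beta>') = k * height (w \<gamma>) + height ?\<theta>"
          by (simp add: w\<beta>' height_add height_scaleR)
        moreover have "0 < k * height (w \<gamma>)" using k height_pos[OF bruhat(1)] by simp
        ultimately show False using height_root_le[OF w\<beta>'_root] by simp
      qed
    next
      assume "real (inv_count y) = inv_count w + 1 - rho_pairing \<gamma>"
      then have neg: "w \<gamma> \<notin> pos"
        and rest: "w \<epsilon> \<notin> pos" "coroot \<gamma> \<bullet> \<epsilon> = 1" if "\<epsilon> \<in> flipped \<gamma> - {\<gamma>}" for \<epsilon>
        using quantum_step_iff[OF w \<gamma>] that unfolding y by auto
      show False
      proof (cases "a \<in> \<Delta>")
        case True
        then show False using rest(1)[of \<beta>] flip(1) ne \<beta>(2) simple_pos by auto
      next
        case False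
        then have a\<theta>: "a = - ?\<theta>" using a by (simp add: affine_simple_def)
        have "k = 1" unfolding k_def using rest(2)[of \<beta>] flip(1) ne by auto
        then have "height (w \<beta>') = height (w \<gamma>) + height ?\<theta>"
          by (simp add: w\<beta>' a\<theta> height_add)
        moreover have "height (w \<beta>') < 0"
          using neg_height[OF w\<beta>'_root] rest(1)[of \<beta>'] flip(2) ne' by blast
        ultimately have "height ?\<theta> < height (- w \<gamma>)" by (simp add: height_uminus)
        then show False
          using height_root_le[of "- w \<gamma>"] uminus_root[OF Weyl_root[OF w pos_root[OF \<gamma>]]] by simp
      qed
    qed
  qed
  then show ?thesis using left_reflection[OF w, of \<gamma> a] \<beta>(2) y by simp
qed

text \<open>
  Here \<open>c = 1\<close> is the case of two ascents of \<open>- \<theta>\<close> and \<open>c = - 1\<close> that of two descents. The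
  change of length along the reflected edge differs from the original one by
  \<open>k \<langle>\<gamma>\<^sup>\<vee>, 2\<rho>\<rangle>\<close> with \<open>k = \<langle>\<theta>\<^sup>\<vee>, w \<gamma>\<rangle>\<close>. In a Bruhat step \<open>k\<close> is 0 or 1, in a quantum step
  0 or \<open>- 1\<close>; a nonzero \<open>k\<close> turns one kind of edge into the other.
\<close>

lemma edge_left_highest:
  assumes edge: "(w, y) \<in> QB"
    and c: "c = 1 \<or> c = - 1"
    and \<gamma>0: "\<gamma>0 \<in> pos" "w \<gamma>0 = - c *\<^sub>R highest_root"
    and \<gamma>1: "\<gamma>1 \<in> pos" "y \<gamma>1 = - c *\<^sub>R highest_root"
  shows "(reflection highest_root \<circ> w, reflection highest_root \<circ> y) \<in> QB"
proof -
  let ?\<theta> = highest_root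
  obtain \<gamma> where w: "w \<in> W" and \<gamma>: "\<gamma> \<in> pos" and y: "y = w \<circ> reflection \<gamma>"
    and step: "inv_count y = inv_count w + 1 \<or> real (inv_count y) = inv_count w + 1 - rho_pairing \<gamma>"
    using edge edge_iff by blast
  have yW: "y \<in> W" using edge edge_Weyl by blast
  define k where "k = coroot ?\<theta> \<bullet> w \<gamma>"
  have length: "real (inv_count (reflection ?\<theta> \<circ> v)) = inv_count v + c * (1 - rho_pairing \<beta>)"
    if "v \<in> W" "\<beta> \<in> pos" "v \<beta> = - c *\<^sub>R ?\<theta>" for v \<beta>
    using c inv_count_left_highest[OF that(1,2)] inv_count_left_highest_descent[OF that(1,2)] that(3)
    by (auto simp: algebra_simps)
  have "w (reflection \<gamma> \<gamma>1) = w \<gamma>0" using \<gamma>0 \<gamma>1 y by simp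
  then have \<gamma>1_eq: "\<gamma>1 = reflection \<gamma> \<gamma>0" using Weyl_eq_iff[OF w] reflection_involutive by metis
  have "coroot \<gamma>0 \<bullet> \<gamma> = - c * k"
    using Weyl_pairing[OF w, of \<gamma>0 \<gamma>] \<gamma>0(2) c by (auto simp: k_def coroot_uminus)
  then have "rho_pairing \<gamma>1 = rho_pairing \<gamma>0 + c * k * rho_pairing \<gamma>"
    unfolding \<gamma>1_eq coroot_reflection by (simp add: inner_add_left algebra_simps)
  then have diff: "real (inv_count (reflection ?\<theta> \<circ> y)) - inv_count (reflection ?\<theta> \<circ> w)
      = real (inv_count y) - inv_count w - k * rho_pairing \<gamma>"
    using length[OF w \<gamma>0] length[OF yW \<gamma>1] c by (auto simp: algebra_simps)
  have "\<gamma> \<noteq> \<gamma>0"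
  proof
    assume "\<gamma> = \<gamma>0"
    then have "\<gamma>1 = - \<gamma>0" using \<gamma>1_eq reflection_self[OF pos_nonzero[OF \<gamma>0(1)]] by simp
    then show False using \<gamma>0(1) \<gamma>1(1) uminus_pos_iff pos_root by blast
  qed
  moreover have "\<gamma> \<noteq> - \<gamma>0" using \<gamma> \<gamma>0(1) uminus_pos_iff pos_root by blast
  ultimately have "w \<gamma> \<noteq> w \<gamma>0" "w \<gamma> \<noteq> w (- \<gamma>0)" using Weyl_eq_iff[OF w] by blast+
  then have ne: "w \<gamma> \<noteq> ?\<theta>" "- w \<gamma> \<noteq> ?\<theta>" using \<gamma>0(2) c by (auto simp: Weyl_uminus[OF w] minus_equation_iff[of "w \<gamma>"])
  have "inv_count (reflection ?\<theta> \<circ> y) = inv_count (reflection ?\<theta> \<circ> w) + 1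
      \<or> real (inv_count (reflection ?\<theta> \<circ> y))
        = inv_count (reflection ?\<theta> \<circ> w) + 1 - rho_pairing \<gamma>"
    using step
  proof
    assume up: "inv_count y = inv_count w + 1"
    then have "w \<gamma> \<in> pos" using Bruhat_step(1)[OF w \<gamma>] y by blast
    then have "k = 0 \<or> k = 1" unfolding k_def using highest_root_pairing ne(1) by blast
    then show ?thesis using diff up by auto
  next
    assume down: "real (inv_count y) = inv_count w + 1 - rho_pairing \<gamma>"
    then have "w \<gamma> \<notin> pos" using quantum_step_iff[OF w \<gamma>] y by blast
    then have "- w \<gamma> \<in> pos" using Weyl_root[OF w pos_root[OF \<gamma>]] by (simp add: uminus_pos_iff)
    then have "k = 0 \<or> k = - 1" unfolding k_def using highest_root_pairing[of "- w \<gamma>"] ne(2) by auto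
    then show ?thesis using diff down by auto
  qed
  moreover have "reflection ?\<theta> \<circ> w \<in> W" using Weyl_comp Weyl_reflection highest_root_root w by blast
  ultimately show ?thesis
    unfolding edge_iff using \<gamma> y by (intro conjI bexI[of _ \<gamma>]) (auto simp: comp_assoc)
qed

text \<open>For a simple root, the lengths at both ends change by the same amount.\<close>

lemma edge_left:
  assumes edge: "(w, y) \<in> QB" and a: "a \<in> affine_simple"
    and same: "ascent a w \<longleftrightarrow> ascent a y"
  shows "(reflection a \<circ> w, reflection a \<circ> y) \<in> QB"
proof -
  have wy: "w \<in> W" "y \<in> W" using edge edge_Weyl by auto
  note root = affine_simple_root[OF a]
  show ?thesis
  proof (cases "a \<in> \<Delta>")
    case True
    have down: "inv_count v = inv_count (reflection a \<circ> v) + 1" if "v \<in> W" "\<not> ascent a v" for v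
    proof -
      have "ascent a (reflection a \<circ> v)"
        using ascent_left_reflection ascent_cases that root by blast
      moreover have "reflection a \<circ> (reflection a \<circ> v) = v" by (rule ext) simp
      ultimately show ?thesis
        using inv_count_left_simple[OF affine_left_Weyl[OF a that(1)] True] by simp
    qed
    have "real (inv_count (reflection a \<circ> y)) - inv_count (reflection a \<circ> w)
        = real (inv_count y) - inv_count w"
      using same inv_count_left_simple[OF wy(1) True] inv_count_left_simple[OF wy(2) True]
        down[OF wy(1)] down[OF wy(2)] by (cases "ascent a w") auto
    moreover obtain \<gamma> where \<gamma>: "\<gamma> \<in> pos" "y = w \<circ> reflection \<gamma>"
      "inv_count y = inv_count w + 1 \<or> real (inv_count y) = inv_count w + 1 - rho_pairing \<gamma>"
      using edge edge_iff by blast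
    ultimately show ?thesis
      unfolding edge_iff using affine_left_Weyl[OF a wy(1)]
      by (intro conjI bexI[of _ \<gamma>]) (auto simp: comp_assoc)
  next
    case False
    then have a\<theta>: "a = - highest_root" using a by (simp add: affine_simple_def)
    show ?thesis
    proof (cases "ascent a w")
      case True
      then obtain \<gamma>0 \<gamma>1 where "\<gamma>0 \<in> pos" "w \<gamma>0 = a" "\<gamma>1 \<in> pos" "y \<gamma>1 = a"
        using same ascentE by metis
      then show ?thesis
        using edge_left_highest[OF edge, of 1 \<gamma>0 \<gamma>1] a\<theta> by (simp add: reflection_uminus)
    next
      case False
      then have "ascent (- a) w" "ascent (- a) y" using same ascent_cases wy root by blast+
      then obtain \<gamma>0 \<gamma>1 where "\<gamma>0 \<in> pos" "w \<gamma>0 = - a" "\<gamma>1 \<in> pos" "y \<gamma>1 = - a"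
        using ascentE by metis
      then show ?thesis
        using edge_left_highest[OF edge, of "- 1" \<gamma>0 \<gamma>1] a\<theta> by (simp add: reflection_uminus)
    qed
  qed
qed

section \<open>Distances in the quantum Bruhat graph\<close>

abbreviation d :: "('a \<Rightarrow> 'a) \<Rightarrow> ('a \<Rightarrow> 'a) \<Rightarrow> nat" where "d \<equiv> qb_dist \<Phi> \<Delta>"

lemma right_simple_edge:
  assumes "w \<in> W" "\<alpha> \<in> \<Delta>"
  shows "(w, w \<circ> reflection \<alpha>) \<in> QB"
proof -
  have "rho_pairing \<alpha> = 2"
    using rho_pairing_eq[of \<alpha>] flipped_simple[OF assms(2)] coroot_inner_self[OF pos_nonzero]
      simple_pos[OF assms(2)] pos_root by simp
  then have "inv_count (w \<circ> reflection \<alpha>) = inv_count w + 1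
      \<or> real (inv_count (w \<circ> reflection \<alpha>)) = inv_count w + 1 - rho_pairing \<alpha>"
    using inv_count_simple[OF assms] by (auto simp: sign_def)
  then show ?thesis unfolding edge_iff using assms simple_pos by blast
qed

lemma connected:
  assumes "w \<in> W" "y \<in> W"
  shows "(w, y) \<in> QB\<^sup>*"
proof -
  obtain w' where w': "w' \<in> W" "\<And>x. w' (w x) = x" "\<And>x. w (w' x) = x"
    using Weyl_inverse assms(1) by blast
  have "(w, w \<circ> v) \<in> QB\<^sup>*" if "v \<in> refl_group \<Delta>" for v
    using that
  proof (induction rule: refl_group_induct)
    case (step v \<alpha>)
    have "w \<circ> v \<in> W" using step(1) assms(1) Weyl_comp Weyl_generated_by_simple by blast
    then have "(w \<circ> v, w \<circ> v \<circ> reflection \<alpha>) \<in> QB" using right_simple_edge step(2) by blast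
    then show ?case using step(3) by (simp only: comp_assoc rtrancl.rtrancl_into_rtrancl)
  qed simp
  moreover have "w' \<circ> y \<in> refl_group \<Delta>"
    using w'(1) assms(2) Weyl_comp Weyl_generated_by_simple by blast
  moreover have "w \<circ> (w' \<circ> y) = y" using w'(3) by (intro ext) simp
  ultimately show ?thesis by metis
qed

lemma dist_path:
  assumes "w \<in> W" "y \<in> W"
  shows "(w, y) \<in> QB ^^ d w y"
proof -
  have "\<exists>n. (w, y) \<in> QB ^^ n" using connected[OF assms] rtrancl_imp_relpow by blast
  then show ?thesis unfolding qb_dist_def by (rule LeastI_ex)
qed

lemma dist_le: "(w, y) \<in> QB ^^ n \<Longrightarrow> d w y \<le> n"
  unfolding qb_dist_def by (rule Least_le)

lemma dist_self: "d w w = 0"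
  using dist_le[of w w 0] by simp

lemma dist_zero: "w \<in> W \<Longrightarrow> y \<in> W \<Longrightarrow> d w y = 0 \<Longrightarrow> w = y"
  using dist_path[of w y] by simp

lemma inv_count_path:
  assumes "(w, y) \<in> QB ^^ n"
  shows "inv_count y \<le> inv_count w + n"
  using assms
proof (induction n arbitrary: y)
  case (Suc n)
  then obtain x where x: "(w, x) \<in> QB ^^ n" "(x, y) \<in> QB" by auto
  have nonneg: "0 \<le> rho_pairing \<gamma>" if "\<gamma> \<in> pos" for \<gamma>
    unfolding rho_pairing_eq[OF pos_root[OF that]]
    by (rule sum_nonneg) (use flipped_pairing[OF that] in fastforce)
  have "inv_count y \<le> inv_count x + 1"
    using x(2) nonneg unfolding edge_iff by (auto dest!: nonneg)
  then show ?case using Suc.IH[OF x(1)] by simp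
qed simp

text \<open>
  A path from an ascent of \<open>a\<close> to a descent must at some point use the edge of left multiplication
  by the reflection; reflecting the part before it, or the part after it, yields a path that is
  shorter by one edge.
\<close>

lemma path_ascent_descent_left:
  assumes "a \<in> affine_simple" "(w, y) \<in> QB ^^ n" "w \<in> W" "ascent a w" "\<not> ascent a y"
  shows "\<exists>m. n = Suc m \<and> (reflection a \<circ> w, y) \<in> QB ^^ m"
  using assms(2-)
proof (induction n arbitrary: w)
  case (Suc n)
  obtain x where x: "(w, x) \<in> QB" "(x, y) \<in> QB ^^ n" using relpow_Suc_D2[OF Suc.prems(1)] by blast
  have xW: "x \<in> W" using x(1) edge_Weyl by blast
  show ?case
  proof (cases "ascent a x")
    case True
    then obtain m where m: "n = Suc m" "(reflection a \<circ> x, y) \<in> QB ^^ m"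
      using Suc.IH[OF x(2) xW] Suc.prems(4) by blast
    have "(reflection a \<circ> w, reflection a \<circ> x) \<in> QB"
      using edge_left[OF x(1) assms(1)] True Suc.prems(3) by blast
    from relpow_Suc_I2[OF this m(2)] show ?thesis using m(1) by blast
  next
    case False
    then have "x = reflection a \<circ> w"
      using edge_ascent_descent[OF x(1) assms(1) Suc.prems(3)] ascent_cases[OF xW]
        affine_simple_root[OF assms(1)] by blast
    then show ?thesis using x(2) by blast
  qed
qed simp

lemma left_reflection_twice: "reflection a \<circ> (reflection a \<circ> w) = w"
  by (rule ext) simp

lemma path_ascent_descent_right:
  assumes "a \<in> affine_simple" "(w, y) \<in> QB ^^ n" "w \<in> W" "ascent a w" "\<not> ascent a y"
  shows "\<exists>m. n = Suc m \<and> (w, reflection a \<circ> y) \<in> QB ^^ m"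
  using assms(2,5)
proof (induction n arbitrary: y)
  case 0
  then show ?case using assms(4) by simp
next
  case (Suc n)
  obtain x where x: "(w, x) \<in> QB ^^ n" "(x, y) \<in> QB" using Suc.prems(1) by auto
  have yW: "y \<in> W" using x(2) edge_Weyl by blast
  show ?case
  proof (cases "ascent a x")
    case True
    then have "y = reflection a \<circ> x"
      using edge_ascent_descent[OF x(2) assms(1) True] ascent_cases[OF yW]
        affine_simple_root[OF assms(1)] Suc.prems(2) by blast
    then show ?thesis using x(1) left_reflection_twice by metis
  next
    case False
    then obtain m where m: "n = Suc m" "(w, reflection a \<circ> x) \<in> QB ^^ m"
      using Suc.IH[OF x(1)] by blast
    have "(reflection a \<circ> x, reflection a \<circ> y) \<in> QB"
      using edge_left[OF x(2) assms(1)] False Suc.prems(2) by blast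
    from relpow_Suc_I[OF m(2) this] show ?thesis using m(1) by blast
  qed
qed

lemma ascent_affine_reflection:
  assumes "a \<in> affine_simple" "w \<in> W"
  shows "ascent a (reflection a \<circ> w) \<longleftrightarrow> \<not> ascent a w"
  using ascent_left_reflection ascent_cases affine_simple_root assms by blast

lemma descent_edge:
  assumes "a \<in> affine_simple" "w \<in> W" "\<not> ascent a w"
  shows "(reflection a \<circ> w, w) \<in> QB"
  using ascent_edge[OF affine_left_Weyl[OF assms(1,2)] assms(1)] ascent_affine_reflection[OF assms(1,2)]
    assms(3) left_reflection_twice[of a w] by simp

text \<open>
  A path may leave the common type of its ends. For ascents the first exit is the edge from some
  \<open>x\<close> to \<open>s\<^sub>a x\<close>; reflecting the part before it saves one edge, which pays for the final edge
  from \<open>y\<close> to \<open>s\<^sub>a y\<close>. For descents the argument runs from the other end.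
\<close>

lemma path_same:
  assumes a: "a \<in> affine_simple" and path: "(w, y) \<in> QB ^^ n" and W: "w \<in> W" "y \<in> W"
    and same: "ascent a w \<longleftrightarrow> ascent a y"
  shows "(reflection a \<circ> w, reflection a \<circ> y) \<in> QB ^^ n"
proof (cases "ascent a y")
  case True
  then have "ascent a w" using same by blast
  with path W(1) show ?thesis
  proof (induction n arbitrary: w)
    case (Suc n)
    obtain x where x: "(w, x) \<in> QB" "(x, y) \<in> QB ^^ n" using relpow_Suc_D2[OF Suc.prems(1)] by blast
    have xW: "x \<in> W" using x(1) edge_Weyl by blast
    show ?case
    proof (cases "ascent a x")
      case True
      then have "(reflection a \<circ> w, reflection a \<circ> x) \<in> QB"
        using edge_left[OF x(1) a] Suc.prems(3) by blast
      from relpow_Suc_I2[OF this Suc.IH[OF x(2) xW True]] show ?thesis .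
    next
      case False
      then have "x = reflection a \<circ> w"
        using edge_ascent_descent[OF x(1) a Suc.prems(3)] ascent_cases[OF xW]
          affine_simple_root[OF a] by blast
      then show ?thesis
        using relpow_Suc_I[OF x(2) ascent_edge[OF W(2) a \<open>ascent a y\<close>]] by (simp only:)
    qed
  qed simp
next
  case False
  then have desc_w: "\<not> ascent a w" using same by blast
  from path W(2) False show ?thesis
  proof (induction n arbitrary: y)
    case (Suc n)
    obtain x where x: "(w, x) \<in> QB ^^ n" "(x, y) \<in> QB" using Suc.prems(1) by auto
    have xW: "x \<in> W" using x(2) edge_Weyl by blast
    show ?case
    proof (cases "ascent a x")
      case True
      then have "y = reflection a \<circ> x"
        using edge_ascent_descent[OF x(2) a True] ascent_cases[OF Suc.prems(2)]
          affine_simple_root[OF a] Suc.prems(3) by blast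
      then have "x = reflection a \<circ> y" using left_reflection_twice by metis
      moreover have "(reflection a \<circ> w, w) \<in> QB" using descent_edge[OF a W(1)] desc_w by blast
      ultimately show ?thesis using relpow_Suc_I2[OF _ x(1)] by (simp only:)
    next
      case False
      then have "(reflection a \<circ> x, reflection a \<circ> y) \<in> QB"
        using edge_left[OF x(2) a] Suc.prems(3) by blast
      from relpow_Suc_I[OF Suc.IH[OF x(1) xW False] this] show ?thesis .
    qed
  qed simp
qed

lemma dist_left:
  assumes a: "a \<in> affine_simple" and W: "w \<in> W" "y \<in> W" and asc: "ascent a w" "\<not> ascent a y"
  shows "d w y = Suc (d (reflection a \<circ> w) y)"
proof (rule antisym)
  have "(reflection a \<circ> w, y) \<in> QB ^^ d (reflection a \<circ> w) y"
    using dist_path affine_left_Weyl a W by blast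
  then show "d w y \<le> Suc (d (reflection a \<circ> w) y)"
    by (rule dist_le[OF relpow_Suc_I2[OF ascent_edge[OF W(1) a asc(1)]]])
  show "Suc (d (reflection a \<circ> w) y) \<le> d w y"
    using path_ascent_descent_left[OF a dist_path[OF W] W(1) asc] dist_le by fastforce
qed

lemma dist_right:
  assumes a: "a \<in> affine_simple" and W: "w \<in> W" "y \<in> W" and asc: "ascent a w" "\<not> ascent a y"
  shows "d w y = Suc (d w (reflection a \<circ> y))"
proof (rule antisym)
  have "(w, reflection a \<circ> y) \<in> QB ^^ d w (reflection a \<circ> y)"
    using dist_path affine_left_Weyl a W by blast
  then show "d w y \<le> Suc (d w (reflection a \<circ> y))"
    by (rule dist_le[OF relpow_Suc_I[OF _ descent_edge[OF a W(2) asc(2)]]])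
  show "Suc (d w (reflection a \<circ> y)) \<le> d w y"
    using path_ascent_descent_right[OF a dist_path[OF W] W(1) asc] dist_le by fastforce
qed

lemma dist_same:
  assumes a: "a \<in> affine_simple" and W: "w \<in> W" "y \<in> W" and same: "ascent a w \<longleftrightarrow> ascent a y"
  shows "d (reflection a \<circ> w) (reflection a \<circ> y) = d w y"
proof (rule antisym)
  show "d (reflection a \<circ> w) (reflection a \<circ> y) \<le> d w y"
    using dist_le path_same[OF a dist_path[OF W] W same] by blast
  have W': "reflection a \<circ> w \<in> W" "reflection a \<circ> y \<in> W" using affine_left_Weyl a W by blast+
  have "ascent a (reflection a \<circ> w) \<longleftrightarrow> ascent a (reflection a \<circ> y)"
    using ascent_affine_reflection a W same by blast
  then show "d w y \<le> d (reflection a \<circ> w) (reflection a \<circ> y)"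
    using dist_le path_same[OF a dist_path[OF W'] W'] left_reflection_twice by metis
qed

section \<open>Gates of cosets\<close>

lemma coset_mem_iff: "y \<in> left_coset z H \<longleftrightarrow> (\<exists>v\<in>H. y = z \<circ> v)"
  unfolding left_coset_def by blast

lemma parabolic_Weyl: "J \<subseteq> \<Delta> \<Longrightarrow> parabolic_subgroup J \<subseteq> W"
  unfolding parabolic_subgroup_def Weyl_generated_by_simple by (rule refl_group_mono)

lemma coset_Weyl: "J \<subseteq> \<Delta> \<Longrightarrow> z \<in> W \<Longrightarrow> y \<in> left_coset z (parabolic_subgroup J) \<Longrightarrow> y \<in> W"
  unfolding coset_mem_iff using parabolic_Weyl Weyl_comp by blast

lemma coset_self: "z \<in> left_coset z (parabolic_subgroup J)"
  unfolding coset_mem_iff parabolic_subgroup_def using id_in_refl_group comp_id by metis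

lemma coset_comp:
  assumes "y \<in> left_coset z (parabolic_subgroup J)" "v \<in> refl_group J"
  shows "y \<circ> v \<in> left_coset z (parabolic_subgroup J)"
  using assms unfolding coset_mem_iff parabolic_subgroup_def by (metis comp_assoc refl_group_comp)

lemma coset_quotient:
  assumes "x \<in> left_coset z (parabolic_subgroup J)" "y \<in> left_coset z (parabolic_subgroup J)"
  obtains v where "v \<in> refl_group J" "y = x \<circ> v"
proof -
  obtain p q where p: "p \<in> refl_group J" "x = z \<circ> p" and q: "q \<in> refl_group J" "y = z \<circ> q"
    using assms unfolding coset_mem_iff parabolic_subgroup_def by blast
  obtain p' where p': "p' \<in> refl_group J" "p \<circ> p' = id" using refl_group_inverse[OF p(1)] by blast
  have "x \<circ> (p' \<circ> q) = z \<circ> (p \<circ> p') \<circ> q" unfolding p(2) by (simp only: comp_assoc)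
  then have "y = x \<circ> (p' \<circ> q)" using p'(2) q(2) by simp
  then show ?thesis using that refl_group_comp[OF p'(1) q(1)] by blast
qed

text \<open>
  If the type of some element of the coset differs from that of its neighbour across the simple root
  \<open>i \<in> J\<close>, then left multiplication by the reflection in \<open>a\<close> is right multiplication by that
  in \<open>i\<close> there, and hence preserves the coset.
\<close>

lemma coset_ascent_cases:
  assumes J: "J \<subseteq> \<Delta>" and z: "z \<in> W" and a: "a \<in> affine_simple"
  defines "C \<equiv> left_coset z (parabolic_subgroup J)"
  shows "(\<forall>y\<in>C. ascent a y) \<or> (\<forall>y\<in>C. \<not> ascent a y) \<or> (\<forall>y\<in>C. reflection a \<circ> y \<in> C)"
proof (cases "\<forall>y\<in>C. \<forall>i\<in>J. ascent a (y \<circ> reflection i) \<longleftrightarrow> ascent a y")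
  case True
  have "ascent a (z \<circ> v) \<longleftrightarrow> ascent a z" if "v \<in> refl_group J" for v
    using that
  proof (induction rule: refl_group_induct)
    case (step v i)
    have "z \<circ> v \<in> C" unfolding C_def using coset_comp[OF coset_self] step(1) by blast
    then have "ascent a (z \<circ> v \<circ> reflection i) \<longleftrightarrow> ascent a (z \<circ> v)" using True step(2) by blast
    then show ?case using step(3) by (simp only: comp_assoc)
  qed simp
  then have "ascent a y \<longleftrightarrow> ascent a z" if "y \<in> C" for y
    using that unfolding C_def coset_mem_iff parabolic_subgroup_def by blast
  then show ?thesis by blast
next
  case False
  then obtain y i where y: "y \<in> C" and i: "i \<in> J" and
    change: "\<not> (ascent a (y \<circ> reflection i) \<longleftrightarrow> ascent a y)" by blast
  have yW: "y \<in> W" using coset_Weyl J z y unfolding C_def by blast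
  have simple: "i \<in> \<Delta>" using i J by blast
  have wall: "v i = a" if v: "ascent a v" "\<not> ascent a (v \<circ> reflection i)" for v
  proof -
    obtain \<gamma> where \<gamma>: "\<gamma> \<in> pos" "v \<gamma> = a" using ascentE[OF v(1)] .
    have "(v \<circ> reflection i) (reflection i \<gamma>) = a" using \<gamma>(2) by simp
    then have "reflection i \<gamma> \<notin> pos" using v(2) unfolding ascent_def by blast
    then show ?thesis using simple_reflection_pos[OF simple \<gamma>(1)] \<gamma>(2) by blast
  qed
  have "y i = a \<or> y i = - a"
  proof (cases "ascent a y")
    case True
    then show ?thesis using wall change by blast
  next
    case False
    have "y \<circ> reflection i \<circ> reflection i = y" by (rule ext) simp
    then have "(y \<circ> reflection i) i = a" using wall[of "y \<circ> reflection i"] change False by metis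
    then have "- y i = a"
      using reflection_self[OF pos_nonzero[OF simple_pos[OF simple]]] Weyl_uminus[OF yW] by simp
    then show ?thesis by auto
  qed
  then have swap: "reflection a \<circ> y = y \<circ> reflection i" using left_reflection[OF yW] by blast
  have "reflection a \<circ> y' \<in> C" if y': "y' \<in> C" for y'
  proof -
    obtain v where v: "v \<in> refl_group J" "y' = y \<circ> v" using coset_quotient y y' unfolding C_def by blast
    have "reflection a \<circ> y' = y \<circ> (reflection i \<circ> v)" unfolding v(2) using swap by (metis comp_assoc)
    moreover have "reflection i \<circ> v \<in> refl_group J"
      using reflection_in_refl_group[OF i] v(1) refl_group_comp by blast
    ultimately show ?thesis using coset_comp y unfolding C_def by metis
  qed
  then show ?thesis by blast
qed

text \<open>
  The gate of a coset, as seen from \<open>u\<close>, lies on a shortest path from \<open>u\<close> to each of its elements: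
  it is the least element of the coset in the tilted order.
\<close>

definition gate :: "('a \<Rightarrow> 'a) \<Rightarrow> ('a \<Rightarrow> 'a) set \<Rightarrow> ('a \<Rightarrow> 'a) \<Rightarrow> bool" where
  "gate u C x \<longleftrightarrow> x \<in> C \<and> (\<forall>y\<in>C. d u y = d u x + d x y)"

definition gated :: "'a set \<Rightarrow> ('a \<Rightarrow> 'a) \<Rightarrow> bool" where
  "gated J u \<longleftrightarrow> (\<forall>z\<in>W. \<exists>x. gate u (left_coset z (parabolic_subgroup J)) x)"

text \<open>
  Moving the observer from \<open>s u\<close> back to \<open>u\<close>: the formulas for distances either leave the gate
  of the coset in place, or move it along with the coset, or, in a coset
  that is stable under \<open>s\<close>, select from the gate \<open>x\<close> and its neighbour \<open>s x\<close> the one with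
  ascent \<open>a\<close>.
\<close>

lemma gated_pull_back:
  assumes J: "J \<subseteq> \<Delta>" and a: "a \<in> affine_simple" and u: "u \<in> W" "ascent a u"
    and gated: "gated J (reflection a \<circ> u)"
  shows "gated J u"
  unfolding gated_def
proof
  fix z assume z: "z \<in> W"
  define s :: "('a \<Rightarrow> 'a) \<Rightarrow> 'a \<Rightarrow> 'a" where "s w = reflection a \<circ> w" for w
  have ss: "s (s w) = w" for w unfolding s_def by (rule left_reflection_twice)
  have sW: "s w \<in> W" if "w \<in> W" for w unfolding s_def using affine_left_Weyl[OF a that] .
  have asc_s: "ascent a (s w) \<longleftrightarrow> \<not> ascent a w" if "w \<in> W" for w
    unfolding s_def using ascent_affine_reflection[OF a that] .
  have left: "d w y = Suc (d (s w) y)" and right: "d w y = Suc (d w (s y))"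
    if "w \<in> W" "y \<in> W" "ascent a w" "\<not> ascent a y" for w y
    unfolding s_def using dist_left[OF a that] dist_right[OF a that] by auto
  have same: "d (s w) (s y) = d w y" if "w \<in> W" "y \<in> W" "ascent a w \<longleftrightarrow> ascent a y" for w y
    unfolding s_def using dist_same[OF a that] .
  let ?C = "left_coset z (parabolic_subgroup J)"
  have CW: "y \<in> W" if "y \<in> ?C" for y using coset_Weyl J z that by blast
  consider "\<forall>y\<in>?C. \<not> ascent a y" | "\<forall>y\<in>?C. ascent a y" | "\<forall>y\<in>?C. s y \<in> ?C"
    using coset_ascent_cases[OF J z a] unfolding s_def by blast
  then show "\<exists>x. gate u ?C x"
  proof cases
    case 1
    obtain x where "gate (s u) ?C x" using gated z unfolding gated_def s_def by blast
    then have x: "x \<in> ?C" and gate: "\<And>y. y \<in> ?C \<Longrightarrow> d (s u) y = d (s u) x + d x y"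
      unfolding gate_def by blast+
    have step: "d u y = Suc (d (s u) y)" if y: "y \<in> ?C" for y
      using left[OF u(1) CW[OF y] u(2)] 1 y by blast
    have "d u y = d u x + d x y" if y: "y \<in> ?C" for y
      using step[OF y] step[OF x] gate[OF y] by linarith
    then show ?thesis using x unfolding gate_def by blast
  next
    case 2
    obtain x where x: "gate (s u) (left_coset (s z) (parabolic_subgroup J)) x"
      using gated sW[OF z] unfolding gated_def s_def by blast
    have image: "left_coset (s z) (parabolic_subgroup J) = s ` ?C"
      unfolding left_coset_def image_image s_def by (rule image_cong) (simp_all only: comp_assoc)
    obtain x' where x': "x' \<in> ?C" "x = s x'" using x unfolding gate_def image by blast
    have "d u y = d u x' + d x' y" if y: "y \<in> ?C" for y
    proof -
      have "d (s u) (s y) = d (s u) (s x') + d (s x') (s y)"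
        using x y unfolding gate_def image x'(2) by blast
      moreover have "d (s u) (s y) = d u y" "d (s u) (s x') = d u x'" "d (s x') (s y) = d x' y"
        using same u CW x'(1) y 2 by blast+
      ultimately show ?thesis by simp
    qed
    then show ?thesis using x'(1) unfolding gate_def by blast
  next
    case 3
    obtain x where "gate (s u) ?C x" using gated z unfolding gated_def s_def by blast
    then have x: "x \<in> ?C" and gate: "\<And>y. y \<in> ?C \<Longrightarrow> d (s u) y = d (s u) x + d x y"
      unfolding gate_def by blast+
    have xW: "x \<in> W" "s x \<in> W" using CW x sW by auto
    have asc_y: "d u y = d (s u) x + d x (s y)" if y: "y \<in> ?C" "ascent a y" for y
    proof -
      have "d (s u) (s y) = d u y" using same[OF u(1) CW[OF y(1)]] y(2) u(2) by blast
      moreover have "s y \<in> ?C" using 3 y(1) by blast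
      ultimately show ?thesis using gate by metis
    qed
    have desc_y: "d u y = Suc (d (s u) x + d x y)" if y: "y \<in> ?C" "\<not> ascent a y" for y
      using left[OF u(1) CW[OF y(1)] u(2) y(2)] gate[OF y(1)] by linarith
    show ?thesis
    proof (cases "ascent a x")
      case True
      have x_sy: "d x (s y) = Suc (d x y)" if y: "y \<in> ?C" "ascent a y" for y
      proof -
        have "d x (s y) = Suc (d (s x) (s y))"
          using left[OF xW(1) sW[OF CW[OF y(1)]] True] asc_s[OF CW[OF y(1)]] y(2) by blast
        moreover have "d (s x) (s y) = d x y" using same[OF xW(1) CW[OF y(1)]] True y(2) by blast
        ultimately show ?thesis by linarith
      qed
      have ux: "d u x = Suc (d (s u) x)"
        using asc_y[OF x True] x_sy[OF x True] dist_self[of x] by linarith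
      have "d u y = d u x + d x y" if y: "y \<in> ?C" for y
      proof (cases "ascent a y")
        case True
        then show ?thesis using asc_y[OF y True] x_sy[OF y True] ux by linarith
      next
        case False
        then show ?thesis using desc_y[OF y False] ux by linarith
      qed
      then show ?thesis using x unfolding gate_def by blast
    next
      case False
      have asc_sx: "ascent a (s x)" using asc_s[OF xW(1)] False by blast
      have sx: "s x \<in> ?C" using 3 x by blast
      have ux: "d u (s x) = d (s u) x" using asc_y[OF sx asc_sx] dist_self[of x] unfolding ss by linarith
      have "d u y = d u (s x) + d (s x) y" if y: "y \<in> ?C" for y
      proof (cases "ascent a y")
        case True
        have "d (s (s x)) (s y) = d (s x) y" using same[OF xW(2) CW[OF y]] asc_sx True by blast
        then show ?thesis using asc_y[OF y True] ux unfolding ss by linarith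
      next
        case False
        have "d (s x) y = Suc (d (s (s x)) y)" using left[OF xW(2) CW[OF y] asc_sx False] .
        then show ?thesis using desc_y[OF y False] ux unfolding ss by linarith
      qed
      then show ?thesis using sx unfolding gate_def by blast
    qed
  qed
qed

lemma parabolic_coeff:
  assumes J: "J \<subseteq> \<Delta>" and v: "v \<in> refl_group J" and "\<delta> \<in> \<Delta> - J"
  shows "coeff \<delta> (v \<beta>) = coeff \<delta> \<beta>"
proof -
  have "coeff \<delta> (reflection i \<beta>) = coeff \<delta> \<beta>" if "i \<in> J" for i \<beta>
  proof -
    have "i \<in> \<Delta>" "\<delta> \<noteq> i" using that assms(1,3) by auto
    then show ?thesis by (simp add: reflection_def coeff_diff coeff_scaleR coeff_simple)
  qed
  with v have "\<forall>\<beta>. coeff \<delta> (v \<beta>) = coeff \<delta> \<beta>" by (induction rule: refl_group_induct) simp_all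
  then show ?thesis by blast
qed

text \<open>
  A nontrivial \<open>v \<in> W\<^sub>J\<close> sends some \<open>i \<in> J\<close> to a negative combination of \<open>J\<close>, which \<open>x\<close>
  keeps negative if it makes all of \<open>J\<close> positive.
\<close>

lemma dominant_unique:
  assumes J: "J \<subseteq> \<Delta>" and x: "x \<in> W" and v: "v \<in> refl_group J"
    and x_pos: "\<And>i. i \<in> J \<Longrightarrow> x i \<in> pos" and xv_pos: "\<And>i. i \<in> J \<Longrightarrow> x (v i) \<in> pos"
  shows "v = id"
proof (rule ccontr)
  assume "v \<noteq> id"
  have vW: "v \<in> W" using v J refl_group_mono Weyl_generated_by_simple by blast
  obtain i where i: "i \<in> \<Delta>" "v i \<notin> pos" using descent_exists[OF vW \<open>v \<noteq> id\<close>] .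
  have root: "v i \<in> \<Phi>" using Weyl_root[OF vW] i(1) simple_subset by blast
  have "i \<in> J"
  proof (rule ccontr)
    assume "i \<notin> J"
    then have "coeff i (v i) = 1" using parabolic_coeff[OF J v] i(1) coeff_simple by simp
    then show False using pos_of_coeff[OF root i(1)] i(2) by simp
  qed
  have "coeff \<delta> (v i) * height (x \<delta>) \<le> 0" if \<delta>: "\<delta> \<in> \<Delta>" for \<delta>
  proof (cases "\<delta> \<in> J")
    case True
    have "coeff \<delta> (v i) \<le> 0" using pos_of_coeff[OF root \<delta>] i(2) by force
    then show ?thesis using height_pos[OF x_pos[OF True]] by (simp add: mult_nonpos_nonneg)
  next
    case False
    then have "coeff \<delta> (v i) = 0"
      using parabolic_coeff[OF J v] \<delta> coeff_simple[OF i(1)] \<open>i \<in> J\<close> by auto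
    then show ?thesis by simp
  qed
  then have "height (x (v i)) \<le> 0" by (subst height_linear_image[OF x]) (rule sum_nonpos)
  then show False using height_pos[OF xv_pos[OF \<open>i \<in> J\<close>]] by simp
qed

text \<open>
  Descending by simple reflections in \<open>J\<close> can only stop at the element of the coset that makes
  \<open>J\<close> positive; backwards, this is a path along which the length goes up by 1 at each edge.
\<close>

lemma dominant_path:
  assumes J: "J \<subseteq> \<Delta>" and x: "x \<in> W" "\<And>i. i \<in> J \<Longrightarrow> x i \<in> pos" and v: "v \<in> refl_group J"
  shows "inv_count x \<le> inv_count (x \<circ> v) \<and> (x, x \<circ> v) \<in> QB ^^ (inv_count (x \<circ> v) - inv_count x)"
  using v
proof (induction "inv_count (x \<circ> v)" arbitrary: v rule: less_induct)
  case less
  have xv: "x \<circ> v \<in> W"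
    using x(1) less.prems J refl_group_mono Weyl_generated_by_simple Weyl_comp by blast
  show ?case
  proof (cases "\<forall>i\<in>J. x (v i) \<in> pos")
    case True
    then have "v = id" using dominant_unique[OF J x(1) less.prems x(2)] by blast
    then show ?thesis by simp
  next
    case False
    then obtain i where i: "i \<in> J" "x (v i) \<notin> pos" by blast
    let ?v = "v \<circ> reflection i"
    have simple: "i \<in> \<Delta>" using i J by blast
    have v': "?v \<in> refl_group J" using less.prems i refl_group_comp reflection_in_refl_group by blast
    have count: "inv_count (x \<circ> v) = Suc (inv_count (x \<circ> ?v))"
      using inv_count_simple[OF xv simple] i(2) by (simp add: sign_def comp_assoc)
    then have IH: "inv_count x \<le> inv_count (x \<circ> ?v)"
      "(x, x \<circ> ?v) \<in> QB ^^ (inv_count (x \<circ> ?v) - inv_count x)"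
      using less.hyps[OF _ v'] by auto
    have "x \<circ> ?v \<in> W" using Weyl_comp[OF xv Weyl_reflection] simple simple_subset by (auto simp: comp_assoc)
    then have "(x \<circ> ?v, x \<circ> ?v \<circ> reflection i) \<in> QB" using right_simple_edge simple by blast
    moreover have "x \<circ> ?v \<circ> reflection i = x \<circ> v" by (rule ext) simp
    ultimately have "(x, x \<circ> v) \<in> QB ^^ Suc (inv_count (x \<circ> ?v) - inv_count x)"
      using relpow_Suc_I[OF IH(2)] by (simp only:)
    then show ?thesis using count IH(1) by (simp add: Suc_diff_le)
  qed
qed

text \<open>No path is shorter, because an edge never raises the length by more than 1.\<close>

lemma dist_dominant:
  assumes "J \<subseteq> \<Delta>" "x \<in> W" "\<And>i. i \<in> J \<Longrightarrow> x i \<in> pos" "v \<in> refl_group J"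
  shows "inv_count (x \<circ> v) = inv_count x + d x (x \<circ> v)"
proof -
  have v: "x \<circ> v \<in> W"
    using assms(1,2,4) refl_group_mono Weyl_generated_by_simple Weyl_comp by blast
  have "inv_count x \<le> inv_count (x \<circ> v)" "d x (x \<circ> v) \<le> inv_count (x \<circ> v) - inv_count x"
    using dominant_path[OF assms] dist_le by auto
  moreover have "inv_count (x \<circ> v) \<le> inv_count x + d x (x \<circ> v)"
    using inv_count_path dist_path[OF assms(2) v] by blast
  ultimately show ?thesis by linarith
qed

text \<open>
  The shortest element of a coset makes \<open>J\<close> positive, and so does the identity for \<open>J = \<Delta>\<close>.
  Hence all distances that occur are differences of lengths.
\<close>

lemma gated_id:
  assumes J: "J \<subseteq> \<Delta>"
  shows "gated J id"
  unfolding gated_def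
proof
  fix z assume z: "z \<in> W"
  let ?C = "left_coset z (parabolic_subgroup J)"
  obtain x where x: "x \<in> ?C" and least: "\<And>y. y \<in> ?C \<Longrightarrow> inv_count x \<le> inv_count y"
    using ex_has_least_nat[of "\<lambda>y. y \<in> ?C" z inv_count] coset_self by blast
  have xW: "x \<in> W" using coset_Weyl J z x by blast
  have dominant: "x i \<in> pos" if i: "i \<in> J" for i
  proof (rule ccontr)
    assume "x i \<notin> pos"
    then have "inv_count (x \<circ> reflection i) < inv_count x"
      using inv_count_simple[OF xW, of i] i J by (auto simp: sign_def)
    then show False
      using least[OF coset_comp[OF x reflection_in_refl_group[OF i]]] by simp
  qed
  have dist_id: "d id y = inv_count y" if "y \<in> W" for y
    using dist_dominant[of \<Delta> id y] that simple_pos Weyl_id inv_count_id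
    unfolding Weyl_generated_by_simple by simp
  have "d id y = d id x + d x y" if y: "y \<in> ?C" for y
  proof -
    obtain v where "v \<in> refl_group J" "y = x \<circ> v" using coset_quotient[OF x y] .
    then show ?thesis
      using dist_dominant[OF J xW dominant] dist_id xW coset_Weyl[OF J z y] by simp
  qed
  then show "\<exists>x. gate id ?C x" using x unfolding gate_def by blast
qed

lemma Weyl_inv:
  assumes "w \<in> W"
  shows "inv w \<in> W" and "w (inv w x) = x" and "inv w (w x) = x"
proof -
  obtain w' where w': "w' \<in> W" "\<And>x. w' (w x) = x" "\<And>x. w (w' x) = x"
    using Weyl_inverse assms by blast
  then have "inv w = w'" by (intro inv_unique_comp) (auto simp: fun_eq_iff)
  then show "inv w \<in> W" "w (inv w x) = x" "inv w (w x) = x" using w' by auto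
qed

text \<open>
  Let \<open>F(a)\<close> be the sum of the heights of \<open>w\<inverse> a\<close> over \<open>w \<in> S\<close>. Pairs \<open>w\<close>, \<open>s\<^sub>a w\<close> that
  both lie in \<open>S\<close> contribute 0, and the remaining \<open>w\<close> contribute negative heights, because \<open>a\<close> is
  a descent of them. So \<open>F(a) \<le> 0\<close> for every affine simple root. But the affine simple roots satisfy
  a linear relation with positive coefficients, \<open>- \<theta>\<close> plus the expansion of \<open>\<theta>\<close>; hence all
  \<open>F(a)\<close> vanish, and \<open>S\<close> is stable under the simple reflections.
\<close>

lemma ascent_closed_full:
  assumes S: "S \<subseteq> W" "S \<noteq> {}"
    and closed: "\<And>w a. w \<in> S \<Longrightarrow> a \<in> affine_simple \<Longrightarrow> ascent a w \<Longrightarrow> reflection a \<circ> w \<in> S"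
  shows "S = W"
proof -
  have fin: "finite S" using finite_subset[OF S(1) finite_Weyl] .
  define F where "F a = (\<Sum>w\<in>S. height (inv w a))" for a
  have F_unpaired: "F a = (\<Sum>w | w \<in> S \<and> reflection a \<circ> w \<notin> S. height (inv w a))"
    if a: "a \<in> affine_simple" for a
  proof -
    let ?P = "{w \<in> S. reflection a \<circ> w \<in> S}" and ?Q = "{w \<in> S. reflection a \<circ> w \<notin> S}"
    have aa: "reflection a a = - a"
      using affine_simple_root[OF a] zero_not_root reflection_self by metis
    have odd: "height (inv (reflection a \<circ> w) a) = - height (inv w a)" if "w \<in> S" for w
    proof -
      have w: "w \<in> W" "reflection a \<circ> w \<in> W" using that S(1) affine_left_Weyl[OF a] by auto
      have "(reflection a \<circ> w) (- inv w a) = a"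
        using Weyl_inv(2)[OF w(1), of a] aa
        by (simp add: Weyl_uminus[OF w(1)] linear_neg[OF linear_reflection])
      then have "inv (reflection a \<circ> w) a = - inv w a" using Weyl_inv(3)[OF w(2)] by metis
      then show ?thesis by (simp add: height_uminus)
    qed
    have "(\<Sum>w\<in>?P. height (inv w a)) = (\<Sum>w\<in>?P. - height (inv w a))"
      by (rule sum.reindex_bij_witness[of _ "\<lambda>w. reflection a \<circ> w" "\<lambda>w. reflection a \<circ> w"])
        (auto simp: left_reflection_twice odd)
    then have "(\<Sum>w\<in>?P. height (inv w a)) = 0" by (simp add: sum_negf)
    moreover have "F a = (\<Sum>w\<in>?P. height (inv w a)) + (\<Sum>w\<in>?Q. height (inv w a))"
      unfolding F_def using fin by (subst sum.union_disjoint[symmetric]) (auto intro!: sum.cong)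
    ultimately show ?thesis by simp
  qed
  have unpaired_neg: "height (inv w a) < 0"
    if "a \<in> affine_simple" "w \<in> S" "reflection a \<circ> w \<notin> S" for a w
  proof (rule neg_height)
    have w: "w \<in> W" using that(2) S(1) by blast
    show "inv w a \<in> \<Phi>" using Weyl_root Weyl_inv(1)[OF w] affine_simple_root that(1) by blast
    have "\<not> ascent a w" using closed that by blast
    then show "inv w a \<notin> pos" unfolding ascent_def using Weyl_inv(2)[OF w, of a] by (metis imageI)
  qed
  have F_nonpos: "F a \<le> 0" if "a \<in> affine_simple" for a
    unfolding F_unpaired[OF that] using unpaired_neg[OF that] by (intro sum_nonpos) (auto simp: less_imp_le)
  let ?\<theta> = highest_root
  have relation: "F (- ?\<theta>) = - (\<Sum>\<delta>\<in>\<Delta>. coeff \<delta> ?\<theta> * F \<delta>)"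
  proof -
    have "height (inv w (- ?\<theta>)) = - (\<Sum>\<delta>\<in>\<Delta>. coeff \<delta> ?\<theta> * height (inv w \<delta>))" if "w \<in> S" for w
    proof -
      have w: "inv w \<in> W" using that S(1) Weyl_inv(1) by blast
      show ?thesis using height_linear_image[OF w, of ?\<theta>] Weyl_uminus[OF w] by (simp add: height_uminus)
    qed
    then have "F (- ?\<theta>) = - (\<Sum>w\<in>S. \<Sum>\<delta>\<in>\<Delta>. coeff \<delta> ?\<theta> * height (inv w \<delta>))"
      unfolding F_def by (simp add: sum_negf)
    also have "(\<Sum>w\<in>S. \<Sum>\<delta>\<in>\<Delta>. coeff \<delta> ?\<theta> * height (inv w \<delta>)) = (\<Sum>\<delta>\<in>\<Delta>. coeff \<delta> ?\<theta> * F \<delta>)"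
      unfolding F_def sum_distrib_left by (rule sum.swap)
    finally show ?thesis .
  qed
  have stable: "reflection \<delta> \<circ> w \<in> S" if \<delta>: "\<delta> \<in> \<Delta>" and w: "w \<in> S" for \<delta> w
  proof (rule ccontr)
    assume unpaired: "reflection \<delta> \<circ> w \<notin> S"
    have affine: "\<epsilon> \<in> affine_simple" if "\<epsilon> \<in> \<Delta>" for \<epsilon> using that by (simp add: affine_simple_def)
    let ?Q = "{w \<in> S. reflection \<delta> \<circ> w \<notin> S}"
    have "F \<delta> < 0"
    proof -
      have "(\<Sum>w\<in>?Q. - height (inv w \<delta>)) > 0"
        using fin w unpaired unpaired_neg[OF affine[OF \<delta>]]
        by (intro sum_pos) auto
      then show ?thesis unfolding F_unpaired[OF affine[OF \<delta>]] by (simp add: sum_negf)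
    qed
    then have "coeff \<delta> ?\<theta> * F \<delta> < 0"
      using highest_root_full_support[OF \<delta>] by (simp add: mult_pos_neg)
    moreover have "(\<Sum>\<epsilon>\<in>\<Delta> - {\<delta>}. coeff \<epsilon> ?\<theta> * F \<epsilon>) \<le> 0"
      using highest_root_full_support F_nonpos affine
      by (intro sum_nonpos mult_nonneg_nonpos) (auto simp: less_imp_le)
    ultimately have "(\<Sum>\<epsilon>\<in>\<Delta>. coeff \<epsilon> ?\<theta> * F \<epsilon>) < 0"
      using sum.remove[OF finite_simple \<delta>, of "\<lambda>\<epsilon>. coeff \<epsilon> ?\<theta> * F \<epsilon>"] by linarith
    then show False using relation F_nonpos[of "- ?\<theta>"] by (simp add: affine_simple_def)
  qed
  obtain w where w: "w \<in> S" using S(2) by blast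
  have group: "\<forall>w\<in>S. v \<circ> w \<in> S" if "v \<in> refl_group \<Delta>" for v
    using that
  proof (induction rule: refl_group_induct)
    case (step v \<alpha>)
    then show ?case using stable by (metis comp_assoc)
  qed simp
  have "W \<subseteq> S"
  proof
    fix y assume y: "y \<in> W"
    have wW: "w \<in> W" using w S(1) by blast
    have "y \<circ> inv w \<in> refl_group \<Delta>"
      using Weyl_comp[OF y Weyl_inv(1)[OF wW]] Weyl_generated_by_simple by blast
    then have "y \<circ> inv w \<circ> w \<in> S" using group w by blast
    moreover have "y \<circ> inv w \<circ> w = y" by (rule ext) (simp add: Weyl_inv(3)[OF wW])
    ultimately show "y \<in> S" by simp
  qed
  then show ?thesis using S(1) by blast
qed

text \<open>
  The elements without gates form a set closed under ascents, by \<open>gated_pull_back\<close>; it misses the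
  identity, so it is empty.
\<close>

lemma gated:
  assumes J: "J \<subseteq> \<Delta>" and u: "u \<in> W"
  shows "gated J u"
proof (rule ccontr)
  assume not_gated: "\<not> gated J u"
  let ?S = "{w \<in> W. \<not> gated J w}"
  have "?S = W"
  proof (rule ascent_closed_full)
    show "?S \<noteq> {}" using u not_gated by blast
    show "reflection a \<circ> w \<in> ?S" if "w \<in> ?S" "a \<in> affine_simple" "ascent a w" for w a
      using that gated_pull_back[OF J] affine_left_Weyl by blast
  qed blast
  then show False using gated_id[OF J] Weyl_id by blast
qed

end

theorem theorem7p1:
  fixes \<Phi> \<Delta> J :: "'a::euclidean_space set"
    and u z :: "'a \<Rightarrow> 'a"
  assumes "irreducible_root_system \<Phi>"
    and "root_base \<Phi> \<Delta>"
    and "J \<subseteq> \<Delta>"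
    and "u \<in> weyl_group \<Phi>"
    and "z \<in> weyl_group \<Phi>"
  shows "\<exists>!x. tilted_minimal \<Phi> \<Delta> u (left_coset z (parabolic_subgroup J)) x"
proof -
  interpret irreducible_based_root_system \<Phi> \<Delta>
    using assms(1,2) by unfold_locales (auto simp: irreducible_root_system_def)
  let ?C = "left_coset z (parabolic_subgroup J)"
  have CW: "y \<in> W" if "y \<in> ?C" for y using coset_Weyl[OF assms(3,5) that] .
  obtain x where x: "x \<in> ?C" and gate: "\<And>y. y \<in> ?C \<Longrightarrow> d u y = d u x + d x y"
    using gated[OF assms(3,4)] assms(5) unfolding gated_def gate_def by blast
  show ?thesis
  proof (rule ex1I[of _ x])
    have "y = x" if "y \<in> ?C" "tilted_le \<Phi> \<Delta> u y x" for y
    proof -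
      have "d u x = d u y + d y x" using that(2) unfolding tilted_le_def by blast
      then have "d x y = 0" using gate[OF that(1)] by simp
      then show ?thesis using dist_zero CW x that(1) by blast
    qed
    then show "tilted_minimal \<Phi> \<Delta> u ?C x" using x unfolding tilted_minimal_def by blast
  next
    fix y assume y: "tilted_minimal \<Phi> \<Delta> u ?C y"
    then have "tilted_le \<Phi> \<Delta> u x y"
      using gate CW x unfolding tilted_minimal_def tilted_le_def by blast
    then show "y = x" using y x unfolding tilted_minimal_def by blast
  qed
qed

end
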